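(* (a) If $p=p(n)$ satisfies $p \geq 1- 1/n + \omega(n)/n^{3/2}$, where $\omega(n) \to \infty$ as $n \to \infty$, then $q^*(G_{n,p})=0$ with high probability. (b) Given $1<c_1<c_2$, there exist $0< \alpha < \beta$ such that, if $p=p(n)$ satisfies $1- c_2/n \leq p \leq 1-c_1/n$, then $\alpha/n \leq q^*(G_{n,p}) \leq \beta/n$ with high probability.
   Context: For a graph $G=(V,E)$ with $m \geq 1$ edges, degrees $d_v$, for $A\subseteq V$ let ${\rm vol}(A)=\sum_{v\in A} d_v$ and let $e(A)$ be the number of edges with both ends in $A$. For a partition $\mathcal{A}$ of $V$, $q_{\mathcal A}(G)=\frac{1}{m}\sum_{A\in\mathcal A} e(A)-\frac{1}{4m^2}\sum_{A\in\mathcal A}{\rm vol}(A)^2$, and $q^*(G)=\max_{\mathcal A} q_{\mathcal A}(G)$; a graph with no edges has $q^*(G)=0$. The binomial random graph $G_{n,p}$ has vertex set $\{1,\dots,n\}$ and each of the $\binom n2$ possible edges is present independently with probability $p$. An event holds with high probability if its probability tends to $1$ as $n\to\infty$. *)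

theory Defs
  imports "HOL-Probability.Probability"
begin

text \<open>
  A finite simple graph on a vertex set \<open>V\<close> is given by its edge set \<open>E\<close>, a set of
  two-element subsets of \<open>V\<close>.
\<close>

definition all_edges :: "'a set \<Rightarrow> 'a set set" where
  "all_edges V = {e. e \<subseteq> V \<and> card e = 2}"

definition vertex_degree :: "'a set set \<Rightarrow> 'a \<Rightarrow> nat" where
  "vertex_degree E v = card {e \<in> E. v \<in> e}"

definition vol :: "'a set set \<Rightarrow> 'a set \<Rightarrow> nat" where
  "vol E A = (\<Sum>v\<in>A. vertex_degree E v)"

definition edges_within :: "'a set set \<Rightarrow> 'a set \<Rightarrow> nat" where
  "edges_within E A = card {e \<in> E. e \<subseteq> A}"

definition modularity_of :: "'a set set \<Rightarrow> 'a set set \<Rightarrow> real" where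
  "modularity_of E \<A> =
     1 / real (card E) * (\<Sum>A\<in>\<A>. real (edges_within E A))
     - 1 / (4 * real (card E) ^ 2) * (\<Sum>A\<in>\<A>. real (vol E A) ^ 2)"

definition modularity :: "'a set \<Rightarrow> 'a set set \<Rightarrow> real" where
  "modularity V E =
     (if E = {} then 0 else Max {modularity_of E \<A> | \<A>. partition_on V \<A>})"

lemma modularity_candidates:
  assumes "finite V"
  shows "finite {modularity_of E \<A> | \<A>. partition_on V \<A>}"
    and "{modularity_of E \<A> | \<A>. partition_on V \<A>} \<noteq> {}"
proof -
  have "{\<A>. partition_on V \<A>} \<subseteq> Pow (Pow V)"
    by (auto simp: partition_on_def)
  then have "finite {\<A>. partition_on V \<A>}"
    using assms by (meson finite_Pow_iff finite_subset)
  then show "finite {modularity_of E \<A> | \<A>. partition_on V \<A>}"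
    by (simp add: setcompr_eq_image)
  have "partition_on V ((\<lambda>v. {v}) ` V)"
    by (auto simp: partition_on_def disjoint_def)
  then show "{modularity_of E \<A> | \<A>. partition_on V \<A>} \<noteq> {}"
    by blast
qed

definition binomial_random_graph :: "nat \<Rightarrow> real \<Rightarrow> nat set set pmf" where
  "binomial_random_graph n p =
     map_pmf (\<lambda>b. {e \<in> all_edges {1..n}. b e})
       (Pi_pmf (all_edges {1..n}) False (\<lambda>_. bernoulli_pmf p))"

lemma pmf_binomial_random_graph:
  assumes p: "0 \<le> p" "p \<le> 1" and E: "E \<subseteq> all_edges {1..n}"
  shows "pmf (binomial_random_graph n p) E = p ^ card E * (1 - p) ^ ((n choose 2) - card E)"
proof -
  let ?K = "all_edges {1..n}" and ?f = "\<lambda>e. e \<in> E"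
  let ?P = "Pi_pmf ?K False (\<lambda>_. bernoulli_pmf p)"
  have fin: "finite ?K" unfolding all_edges_def by simp
  have card: "card ?K = n choose 2"
    unfolding all_edges_def using n_subsets[of "{1..n}" 2] by simp
  have "pmf (binomial_random_graph n p) E = measure ?P ((\<lambda>b. {e \<in> ?K. b e}) -` {E})"
    unfolding binomial_random_graph_def by (simp add: pmf_map)
  also have "\<dots> = measure ?P {?f}"
  proof (rule measure_pmf.finite_measure_eq_AE)
    show "AE b in ?P. (b \<in> (\<lambda>b. {e \<in> ?K. b e}) -` {E}) = (b \<in> {?f})"
      using set_Pi_pmf_subset[OF fin, of False "\<lambda>_. bernoulli_pmf p"] E
      by (auto simp: AE_measure_pmf_iff fun_eq_iff)
  qed simp_all
  also have "\<dots> = (\<Prod>e\<in>?K. pmf (bernoulli_pmf p) (e \<in> E))"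
    using E by (subst measure_pmf_single, subst pmf_Pi'[OF fin]) auto
  also have "\<dots> = (\<Prod>e\<in>E. pmf (bernoulli_pmf p) (e \<in> E))
                    * (\<Prod>e\<in>?K - E. pmf (bernoulli_pmf p) (e \<in> E))"
    by (subst prod.subset_diff[OF E fin]) (rule mult.commute)
  also have "\<dots> = p ^ card E * (1 - p) ^ card (?K - E)"
    using p by simp
  also have "card (?K - E) = (n choose 2) - card E"
    using card_Diff_subset[OF finite_subset[OF E fin] E] card by simp
  finally show ?thesis .
qed

end

theory Submission
  imports Defs
begin

text \<open>
  For a graph with \<open>m\<close> edges, a partition \<open>\<A>\<close> has modularity
  \<open>1 / (4 m\<^sup>2)\<close> times the sum over its parts \<open>A\<close> of \<open>4 e(A) e(V - A) - cut(A)\<^sup>2\<close>.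
  In terms of the complement graph \<open>H\<close> with \<open>M\<close> edges, this gain is at most
  \<open>|A| |V - A| (2 M - (n - 1))\<close>. Hence the modularity vanishes as soon as \<open>2 M \<le> n - 1\<close>, which gives
  (a) by Chebyshev's inequality, and it is \<open>O(M / n\<^sup>2) = O(1 / n)\<close> in case (b).

  For the lower bound in (b), a nearly balanced bipartition with \<open>x\<close> crossing edges of \<open>H\<close> has gain
  about \<open>n\<^sup>2 (x - M / 2 - n / 4)\<close>. Suppose the vertices are grouped into small clusters, each with a
  2-colouring. Flipping the colours of whole clusters suitably cuts half of the edges between
  clusters and keeps the sides balanced, so a linear gain follows if the colourings cut, within the
  clusters, \<open>(1/2 + \<epsilon>) n\<close> more edges than they leave uncut. The clusters are the components
  of \<open>H\<^sub>0 \<union> P\<close>, where \<open>H\<^sub>0 \<subseteq> H\<close> is a thinned copy with edge probability \<open>(1 - \<eta>) / n\<close>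
  and \<open>P\<close> consists of the edges of \<open>H\<close> that have an end of degree one in \<open>H\<close>. Since \<open>H\<^sub>0\<close> is
  subcritical, and an edge of \<open>P\<close> can only be the first or the last one of a path, counting paths
  shows that the clusters are small and that all but \<open>O(1)\<close> of their edges are bridges. Bridges can
  be coloured properly. There are about \<open>(1 - \<eta>) n / 2\<close> edges in \<open>H\<^sub>0\<close>, and \<open>P\<close> adds linearly many,
  with a constant that does not depend on \<open>\<eta>\<close>.
\<close>

subsection \<open>Modularity through the complement graph\<close>

lemma finite_all_edges: "finite V \<Longrightarrow> finite (all_edges V)"
  unfolding all_edges_def by simp

lemma card_all_edges: "finite V \<Longrightarrow> card (all_edges V) = card V choose 2"
  unfolding all_edges_def by (rule n_subsets)

lemma all_edgesE:
  assumes "e \<in> all_edges V"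
  obtains u v where "e = {u, v}" "u \<noteq> v" "u \<in> V" "v \<in> V"
  using assms by (auto simp: all_edges_def card_2_iff)

lemma doubleton_in_all_edges: "{u, v} \<in> all_edges V \<longleftrightarrow> u \<in> V \<and> v \<in> V \<and> u \<noteq> v"
  by (auto simp: all_edges_def card_2_iff doubleton_eq_iff)

lemma finite_edge_set: "finite V \<Longrightarrow> E \<subseteq> all_edges V \<Longrightarrow> finite E"
  using finite_all_edges finite_subset by blast

lemma of_nat_choose_two: "real (n choose 2) = real n * (real n - 1) / 2"
  by (cases n) (auto simp: choose_two field_simps real_of_nat_div)

section \<open>Edges inside a part, outside it and across its boundary\<close>

definition cut :: "'a set set \<Rightarrow> 'a set \<Rightarrow> 'a set \<Rightarrow> nat" where
  "cut E A B = card {e \<in> E. \<not> e \<subseteq> A \<and> \<not> e \<subseteq> B}"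

lemma card_edges_split:
  assumes "finite V" "E \<subseteq> all_edges V" "A \<subseteq> V"
  shows "card E = edges_within E A + edges_within E (V - A) + cut E A (V - A)"
proof -
  have fin: "finite E" using assms finite_edge_set by blast
  have ne: "e \<noteq> {}" if "e \<in> E" for e using that assms by (auto simp: all_edges_def)
  have "card E = card ({e \<in> E. e \<subseteq> A} \<union> {e \<in> E. e \<subseteq> V - A}
      \<union> {e \<in> E. \<not> e \<subseteq> A \<and> \<not> e \<subseteq> V - A})"
    by (rule arg_cong[of _ _ card]) auto
  also have "\<dots> = card ({e \<in> E. e \<subseteq> A} \<union> {e \<in> E. e \<subseteq> V - A})
      + card {e \<in> E. \<not> e \<subseteq> A \<and> \<not> e \<subseteq> V - A}"
    using fin by (intro card_Un_disjoint) auto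
  also have "card ({e \<in> E. e \<subseteq> A} \<union> {e \<in> E. e \<subseteq> V - A})
      = card {e \<in> E. e \<subseteq> A} + card {e \<in> E. e \<subseteq> V - A}"
    using fin ne by (intro card_Un_disjoint) auto
  finally show ?thesis by (simp add: edges_within_def cut_def)
qed

lemma vol_eq_sum_card_Int:
  assumes "finite E" "finite A"
  shows "vol E A = (\<Sum>e\<in>E. card (e \<inter> A))"
proof -
  have "vol E A = (\<Sum>v\<in>A. \<Sum>e\<in>E. of_bool (v \<in> e))"
    using assms by (simp add: vol_def vertex_degree_def Int_def)
  also have "\<dots> = (\<Sum>e\<in>E. \<Sum>v\<in>A. of_bool (v \<in> e))" by (rule sum.swap)
  also have "\<dots> = (\<Sum>e\<in>E. card (e \<inter> A))"
    using assms by (intro sum.cong refl) (simp add: Int_commute)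
  finally show ?thesis .
qed

lemma vol_eq:
  assumes "finite V" "E \<subseteq> all_edges V" "A \<subseteq> V"
  shows "vol E A = 2 * edges_within E A + cut E A (V - A)"
proof -
  have fin: "finite E" using assms finite_edge_set by blast
  have c: "card (e \<inter> A) = 2 * (if e \<subseteq> A then 1 else 0)
      + (if \<not> e \<subseteq> A \<and> \<not> e \<subseteq> V - A then 1 else 0)" if eE: "e \<in> E" for e
  proof -
    obtain u v where e: "e = {u, v}" "u \<noteq> v" "u \<in> V" "v \<in> V"
      using subsetD[OF assms(2) eE] by (rule all_edgesE)
    have "card ({u, v} \<inter> A) = (if u \<in> A then 1 else 0) + (if v \<in> A then 1 else 0)"
      using e(2) by (auto simp: Int_insert_left)
    then show ?thesis using e(3,4) unfolding e(1) by simp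
  qed
  have "vol E A = (\<Sum>e\<in>E. card (e \<inter> A))"
    by (rule vol_eq_sum_card_Int[OF fin finite_subset[OF assms(3,1)]])
  also have "\<dots> = (\<Sum>e\<in>E. 2 * (if e \<subseteq> A then 1 else 0)
      + (if \<not> e \<subseteq> A \<and> \<not> e \<subseteq> V - A then 1 else 0))"
    by (intro sum.cong refl c)
  also have "\<dots> = 2 * edges_within E A + cut E A (V - A)"
    using fin by (simp add: sum.distrib sum.If_cases Int_def edges_within_def cut_def
        flip: sum_distrib_left)
  finally show ?thesis .
qed

text \<open>This is \<open>4 m\<^sup>2\<close> times the contribution of \<open>A\<close> to the
  modularity. In this form volumes disappear and the expression is symmetric in \<open>A\<close> and
  \<open>V - A\<close>.\<close>

definition part_gain :: "'a set \<Rightarrow> 'a set set \<Rightarrow> 'a set \<Rightarrow> real" where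
  "part_gain V E A =
     4 * real (edges_within E A) * real (edges_within E (V - A)) - real (cut E A (V - A)) ^ 2"

lemma modularity_of_eq_part_gain:
  assumes "finite V" "E \<subseteq> all_edges V" "E \<noteq> {}" "partition_on V \<A>"
  shows "modularity_of E \<A> = (\<Sum>A\<in>\<A>. part_gain V E A) / (4 * real (card E) ^ 2)"
proof -
  let ?m = "real (card E)"
  have m: "?m > 0" using assms finite_edge_set card_gt_0_iff by fastforce
  have "1 / ?m * real (edges_within E A) - 1 / (4 * ?m ^ 2) * real (vol E A) ^ 2
      = part_gain V E A / (4 * ?m ^ 2)" if "A \<in> \<A>" for A
  proof -
    have A: "A \<subseteq> V" using that assms(4) by (auto simp: partition_on_def)
    define a b x where abx: "a = real (edges_within E A)" "b = real (edges_within E (V - A))"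
      "x = real (cut E A (V - A))"
    have mm: "?m = a + b + x" using card_edges_split[OF assms(1,2) A] by (simp add: abx)
    have v: "real (vol E A) = 2 * a + x" using vol_eq[OF assms(1,2) A] by (simp add: abx)
    \<comment> \<open>The terms in \<open>a\<^sup>2\<close> and \<open>a * x\<close> cancel.\<close>
    have "4 * ?m * a - (2 * a + x) ^ 2 = 4 * a * b - x ^ 2"
      unfolding mm by (simp add: power2_eq_square algebra_simps)
    then show ?thesis unfolding part_gain_def v abx(1)[symmetric] abx(2,3)[symmetric] using m
      by (simp add: field_simps power2_eq_square)
  qed
  then show ?thesis
    unfolding modularity_of_def sum_distrib_left sum_divide_distrib sum_subtractf[symmetric]
    by (intro sum.cong) auto
qed


lemma modularity_ge:
  assumes "finite V" "E \<noteq> {}" "partition_on V \<A>"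
  shows "modularity_of E \<A> \<le> modularity V E"
  unfolding modularity_def using modularity_candidates[OF assms(1), of E] assms
  by (auto intro!: Max_ge)

lemma modularity_le:
  assumes "finite V" "E \<noteq> {}" "\<And>\<A>. partition_on V \<A> \<Longrightarrow> modularity_of E \<A> \<le> c"
  shows "modularity V E \<le> c"
  unfolding modularity_def using modularity_candidates[OF assms(1), of E] assms
  by auto

lemma modularity_nonneg:
  assumes "finite V" "V \<noteq> {}" "E \<subseteq> all_edges V"
  shows "0 \<le> modularity V E"
proof (cases "E = {}")
  case False
  \<comment> \<open>The one-part partition has no edges outside its part and none cut, so its gain
    is 0.\<close>
  have p: "partition_on V {V}" using assms by (auto simp: partition_on_def)
  have e: "{e \<in> E. e \<subseteq> V} = E" "{e \<in> E. e \<subseteq> {}} = {}" "{e \<in> E. \<not> e \<subseteq> V \<and> e \<noteq> {}} = {}"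
    using assms by (auto simp: all_edges_def)
  have "modularity_of E {V} = 0"
    using modularity_of_eq_part_gain[OF assms(1,3) False p] e
    by (simp add: part_gain_def edges_within_def cut_def)
  then show ?thesis using modularity_ge[OF assms(1) False p] by simp
qed (simp add: modularity_def)

section \<open>Gains expressed through the sparse complement graph\<close>

lemma edges_within_complement:
  assumes "finite V" "H \<subseteq> all_edges V" "A \<subseteq> V"
  shows "real (edges_within (all_edges V - H) A)
    = real (card A) * (real (card A) - 1) / 2 - real (edges_within H A)"
proof -
  have "{e \<in> all_edges V. e \<subseteq> A} = all_edges A" using assms by (auto simp: all_edges_def)
  then have eq: "{e \<in> all_edges V - H. e \<subseteq> A} = all_edges A - {e \<in> H. e \<subseteq> A}" by auto
  have sub: "{e \<in> H. e \<subseteq> A} \<subseteq> all_edges A" using assms by (auto simp: all_edges_def)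
  have finA: "finite A" using assms finite_subset by blast
  have "real (card (all_edges A - {e \<in> H. e \<subseteq> A}))
      = real (card (all_edges A)) - real (card {e \<in> H. e \<subseteq> A})"
    using sub finA finite_edge_set[OF finA sub] card_mono[OF finite_all_edges[OF finA] sub]
    by (simp add: card_Diff_subset)
  then show ?thesis
    unfolding edges_within_def eq card_all_edges[OF finA] of_nat_choose_two .
qed

lemma card_complement:
  assumes "finite V" "H \<subseteq> all_edges V"
  shows "real (card (all_edges V - H)) = real (card V) * (real (card V) - 1) / 2 - real (card H)"
proof -
  have e: "{e \<in> F. e \<subseteq> V} = F" if "F \<subseteq> all_edges V" for F
    using that by (auto simp: all_edges_def)
  show ?thesis using edges_within_complement[OF assms order_refl]
    unfolding edges_within_def e[OF assms(2)] e[OF Diff_subset] .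
qed

text \<open>After substitution the leading terms \<open>a\<^sup>2 * b\<^sup>2\<close> of the product
  and of the squared cut cancel. A complete graph has gain \<open>- a * b * (n - 1)\<close>; the
  remaining terms are the correction caused by the removed edges \<open>H\<close>.\<close>

lemma part_gain_complement:
  fixes V :: "'a set"
  assumes "finite V" "H \<subseteq> all_edges V" "A \<subseteq> V"
  defines "n \<equiv> real (card V)" and "a \<equiv> real (card A)" and "b \<equiv> real (card (V - A))"
    and "M \<equiv> real (card H)" and "\<alpha> \<equiv> real (edges_within H A)"
    and "\<beta> \<equiv> real (edges_within H (V - A))" and "x \<equiv> real (cut H A (V - A))"
  shows "part_gain V (all_edges V - H) A
     = a * b * (2 * M - (n - 1)) - 2 * (n - 1) * (a * \<beta> + b * \<alpha>) + 4 * \<alpha> * \<beta> - x ^ 2"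
proof -
  let ?E = "all_edges V - H"
  have n: "n = a + b" using assms card_Diff_subset[of A V] card_mono[of V A] finite_subset[of A V]
    by simp
  have M: "M = \<alpha> + \<beta> + x" using card_edges_split[OF assms(1-3)] by (simp add: assms)
  have eA: "real (edges_within ?E A) = a * (a - 1) / 2 - \<alpha>"
    using edges_within_complement[OF assms(1-3)] by (simp add: assms)
  have eB: "real (edges_within ?E (V - A)) = b * (b - 1) / 2 - \<beta>"
    using edges_within_complement[OF assms(1,2), of "V - A"] by (simp add: assms)
  have "real (card ?E) = n * (n - 1) / 2 - M"
    using card_complement[OF assms(1,2)] by (simp add: assms)
  moreover have "real (card ?E) = real (edges_within ?E A) + real (edges_within ?E (V - A))
      + real (cut ?E A (V - A))"
    using card_edges_split[of V ?E A] assms(1,3) by simp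
  ultimately have x: "real (cut ?E A (V - A)) = a * b - x"
    unfolding eA eB n M by (simp add: field_simps)
  show ?thesis unfolding part_gain_def eA eB x n M
    by (simp add: power2_eq_square field_simps)
qed

lemma edges_within_le:
  assumes "finite A" "A \<subseteq> V" "H \<subseteq> all_edges V"
  shows "2 * real (edges_within H A) \<le> real (card A) * (real (card A) - 1)"
proof -
  have "{e \<in> H. e \<subseteq> A} \<subseteq> all_edges A" using assms by (auto simp: all_edges_def)
  then have "card {e \<in> H. e \<subseteq> A} \<le> card A choose 2"
    using card_mono[OF finite_all_edges[OF assms(1)]] card_all_edges[OF assms(1)] by metis
  then have "real (edges_within H A) \<le> real (card A choose 2)" by (simp add: edges_within_def)
  then show ?thesis by (simp add: of_nat_choose_two)
qed

text \<open>Since \<open>A\<close> spans at most \<open>a * (a - 1) / 2\<close> edges of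
  \<open>H\<close>, the only positive correction \<open>4 * \<alpha> * \<beta>\<close> is absorbed
  by the negative term \<open>2 * (n - 1) * a * \<beta>\<close>.\<close>

lemma part_gain_complement_le:
  assumes "finite V" "H \<subseteq> all_edges V" "A \<subseteq> V"
  shows "part_gain V (all_edges V - H) A
    \<le> real (card A) * real (card (V - A)) * (2 * real (card H) - (real (card V) - 1))"
proof (cases "A = {}")
  case True
  have "edges_within (all_edges V - H) {} = 0"
    by (auto simp: edges_within_def all_edges_def card_eq_0_iff)
  then show ?thesis using True by (simp add: part_gain_def)
next
  case False
  define n a b \<alpha> \<beta> where d: "n = real (card V)" "a = real (card A)" "b = real (card (V - A))"
    "\<alpha> = real (edges_within H A)" "\<beta> = real (edges_within H (V - A))"
  have finA: "finite A" using assms finite_subset by blast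
  have a1: "a \<ge> 1" using False finA by (simp add: d Suc_leI card_gt_0_iff)
  have an: "a \<le> n" using assms by (simp add: d card_mono)
  have "2 * \<alpha> \<le> a * (a - 1)" using edges_within_le[OF finA assms(3,2)] by (simp add: d)
  also have "\<dots> \<le> a * (n - 1)" using an a1 by (intro mult_left_mono) auto
  finally have "2 * \<alpha> * (2 * \<beta>) \<le> a * (n - 1) * (2 * \<beta>)"
    by (rule mult_right_mono) (simp add: d)
  moreover have "0 \<le> (n - 1) * (b * \<alpha>)" using a1 an by (simp add: d)
  ultimately have "4 * \<alpha> * \<beta> \<le> 2 * (n - 1) * (a * \<beta> + b * \<alpha>)"
    by (simp add: algebra_simps)
  then show ?thesis unfolding part_gain_complement[OF assms] using d
    by (smt (verit) zero_le_power2)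
qed

lemma sum_card_partition:
  assumes "finite V" "partition_on V \<A>"
  shows "(\<Sum>A\<in>\<A>. card A) = card V"
proof -
  have "card (\<Union>\<A>) = sum card \<A>"
  proof (rule card_Union_disjoint)
    show "pairwise disjnt \<A>"
      using partition_onD2[OF assms(2)] by (auto simp: disjoint_def pairwise_def disjnt_def)
    show "\<And>A. A \<in> \<A> \<Longrightarrow> finite A"
      using assms by (metis Union_upper finite_subset partition_onD1)
  qed
  then show ?thesis using partition_onD1[OF assms(2)] by simp
qed

text \<open>The factor \<open>2 M - (n - 1)\<close> in the bound on each gain is nonpositive, so no
  partition beats the trivial one.\<close>

lemma modularity_eq_0:
  assumes "finite V" "V \<noteq> {}" "H \<subseteq> all_edges V" "2 * real (card H) \<le> real (card V) - 1"
  shows "modularity V (all_edges V - H) = 0"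
proof (cases "all_edges V - H = {}")
  case False
  have "modularity V (all_edges V - H) \<le> 0"
  proof (rule modularity_le[OF assms(1) False])
    fix \<A> assume p: "partition_on V \<A>"
    have "part_gain V (all_edges V - H) A \<le> 0" if "A \<in> \<A>" for A
    proof -
      have "A \<subseteq> V" using that p by (auto simp: partition_on_def)
      from part_gain_complement_le[OF assms(1,3) this] show ?thesis
        using assms(4) by (smt (verit) mult_nonneg_nonpos mult_nonneg_nonneg of_nat_0_le_iff)
    qed
    then show "modularity_of (all_edges V - H) \<A> \<le> 0"
      unfolding modularity_of_eq_part_gain[OF assms(1) Diff_subset False p]
      by (intro divide_nonpos_nonneg sum_nonpos) auto
  qed
  then show ?thesis using modularity_nonneg[of V "all_edges V - H"] assms by simp
qed (simp add: modularity_def)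

text \<open>Bounding \<open>card (V - A)\<close> by \<open>n\<close> and dropping
  \<open>- (n - 1)\<close> leaves \<open>2 * n * M\<close> per vertex of the part, and the sizes of
  the parts add up to \<open>n\<close>.\<close>

lemma modularity_complement_le:
  assumes "finite V" "H \<subseteq> all_edges V" "all_edges V - H \<noteq> {}"
  shows "modularity V (all_edges V - H)
    \<le> real (card V) ^ 2 * real (card H) / (2 * real (card (all_edges V - H)) ^ 2)"
proof (rule modularity_le[OF assms(1,3)])
  fix \<A> assume p: "partition_on V \<A>"
  let ?n = "real (card V)" and ?M = "real (card H)"
  have n1: "?n \<ge> 1" using assms by (auto simp: all_edges_def Suc_le_eq card_gt_0_iff)
  have "part_gain V (all_edges V - H) A \<le> real (card A) * (?n * (2 * ?M))" if "A \<in> \<A>" for A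
  proof -
    have A: "A \<subseteq> V" using that p by (auto simp: partition_on_def)
    have "part_gain V (all_edges V - H) A \<le> real (card A) * real (card (V - A)) * (2 * ?M - (?n - 1))"
      by (rule part_gain_complement_le[OF assms(1,2) A])
    also have "\<dots> \<le> real (card A) * real (card (V - A)) * (2 * ?M)"
      using n1 by (intro mult_left_mono) auto
    also have "\<dots> \<le> real (card A) * ?n * (2 * ?M)"
      using assms(1) by (intro mult_right_mono mult_left_mono) (auto intro: card_mono)
    finally show ?thesis by (simp add: mult.assoc)
  qed
  then have "(\<Sum>A\<in>\<A>. part_gain V (all_edges V - H) A) \<le> (\<Sum>A\<in>\<A>. real (card A) * (?n * (2 * ?M)))"
    by (rule sum_mono)
  also have "\<dots> = ?n * (?n * (2 * ?M))"
    by (simp add: sum_card_partition[OF assms(1) p] flip: sum_distrib_right of_nat_sum)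
  finally have "(\<Sum>A\<in>\<A>. part_gain V (all_edges V - H) A) / (4 * real (card (all_edges V - H)) ^ 2)
      \<le> ?n * (?n * (2 * ?M)) / (4 * real (card (all_edges V - H)) ^ 2)"
    by (rule divide_right_mono) simp
  then show "modularity_of (all_edges V - H) \<A> \<le> ?n ^ 2 * ?M / (2 * real (card (all_edges V - H)) ^ 2)"
    unfolding modularity_of_eq_part_gain[OF assms(1) Diff_subset assms(3) p]
    by (simp add: power2_eq_square mult.assoc)
qed

subsection \<open>Signs, clusters and paths\<close>

definition adj :: "'a set set \<Rightarrow> ('a \<times> 'a) set" where
  "adj F = {(u, v). {u, v} \<in> F}"

text \<open>
  The edges that a 2-colouring of the components of \<open>F\<close> might fail to cut: those of \<open>F\<close> that are
  not bridges, and those of \<open>H - F\<close> with both ends in one component.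
\<close>

definition bad_edges :: "'a set set \<Rightarrow> 'a set set \<Rightarrow> 'a set set" where
  "bad_edges F H = {e \<in> H. \<exists>u v. e = {u, v} \<and> (u, v) \<in> (adj (F - {e}))\<^sup>*}"

text \<open>The number of these ordered pairs, diagonal included, is the sum of the squared cluster
  sizes. It controls how unbalanced the two sides can become when whole clusters are
  flipped.\<close>

definition linked_pairs :: "'a set \<Rightarrow> 'a set set \<Rightarrow> ('a \<times> 'a) set" where
  "linked_pairs V F = {(u, v). u \<in> V \<and> v \<in> V \<and> (u, v) \<in> (adj F)\<^sup>*}"

lemma adj_rtrancl_mono: "F \<subseteq> F' \<Longrightarrow> (adj F)\<^sup>* \<subseteq> (adj F')\<^sup>*"
  by (rule rtrancl_mono) (auto simp: adj_def)

lemma sym_adj_rtrancl: "sym ((adj F)\<^sup>*)"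
  by (rule sym_rtrancl) (auto simp: sym_def adj_def insert_commute)

lemma equiv_adj_rtrancl: "equiv UNIV ((adj F)\<^sup>*)"
  by (intro equivI sym_adj_rtrancl refl_rtrancl trans_rtrancl) simp

lemma adj_rtrancl_cong:
  assumes "{x, y} \<in> F"
  shows "(u, x) \<in> (adj F)\<^sup>* \<longleftrightarrow> (u, y) \<in> (adj F)\<^sup>*"
proof -
  have "(x, y) \<in> adj F" "(y, x) \<in> adj F" using assms by (auto simp: adj_def insert_commute)
  then show ?thesis by (meson rtrancl.rtrancl_into_rtrancl)
qed

text \<open>Edges are added one at a time. A new edge is a bridge, so its ends lie in different
  components of the old graph; if their colours agree, one of these components is
  recoloured.\<close>

lemma bridges_two_colouring:
  assumes "finite B" "\<And>u v. {u, v} \<in> B \<Longrightarrow> (u, v) \<notin> (adj (B - {{u, v}}))\<^sup>*"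
  shows "\<exists>s :: 'a \<Rightarrow> real. (\<forall>v. s v = 1 \<or> s v = -1) \<and> (\<forall>u v. {u, v} \<in> B \<longrightarrow> s u * s v = -1)"
  using assms
proof (induction B rule: finite_induct)
  case empty
  show ?case by (rule exI[of _ "\<lambda>_. 1"]) auto
next
  case (insert e B)
  have "(x, y) \<notin> (adj (B - {{x, y}}))\<^sup>*" if "{x, y} \<in> B" for x y
    using insert.prems[of x y] that adj_rtrancl_mono[of "B - {{x, y}}" "insert e B - {{x, y}}"]
    by blast
  with insert.IH obtain s :: "'a \<Rightarrow> real" where s: "\<And>v. s v = 1 \<or> s v = -1"
    "\<And>x y. {x, y} \<in> B \<Longrightarrow> s x * s y = -1" by blast
  show ?case
  proof (cases "\<exists>u v. e = {u, v} \<and> s u = s v")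
    case False
    have "s x * s y = -1" if "{x, y} \<in> insert e B" for x y
    proof (cases "{x, y} \<in> B")
      case True
      then show ?thesis by (rule s(2))
    next
      case nB: False
      then have "e = {x, y}" using that by auto
      then have "s x \<noteq> s y" using False by blast
      then show ?thesis using s(1)[of x] s(1)[of y] by auto
    qed
    then show ?thesis using s(1) by (intro exI[of _ s]) auto
  next
    case True
    then obtain u v where uv: "e = {u, v}" "s u = s v" by blast
    \<comment> \<open>Flip the component of \<open>u\<close>. It contains both ends or neither end
      of each old edge, so old edges stay properly coloured, while \<open>v\<close> keeps its
      colour.\<close>
    define s' where "s' w = (if (u, w) \<in> (adj B)\<^sup>* then - s w else s w)" for w
    have "insert e B - {{u, v}} = B" using insert.hyps uv by auto
    then have nuv: "(u, v) \<notin> (adj B)\<^sup>*" using insert.prems[of u v] uv by simp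
    have e: "s' u * s' v = -1" using nuv uv s(1)[of v] by (auto simp: s'_def)
    have "s' x * s' y = -1" if "{x, y} \<in> insert e B" for x y
    proof (cases "{x, y} = e")
      case True
      then have "x = u \<and> y = v \<or> x = v \<and> y = u" using uv by (auto simp: doubleton_eq_iff)
      then show ?thesis using e by (auto simp: mult.commute)
    next
      case False
      then have xy: "{x, y} \<in> B" using that by auto
      show ?thesis using s(2)[OF xy] adj_rtrancl_cong[OF xy] by (auto simp: s'_def)
    qed
    moreover have "s' w = 1 \<or> s' w = -1" for w using s(1)[of w] by (auto simp: s'_def)
    ultimately show ?thesis by (intro exI[of _ s']) auto
  qed
qed

text \<open>For independent uniform signs the off-diagonal terms vanish in expectation. The
  induction derandomises this by choosing the signs greedily.\<close>

lemma exists_signs: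
  fixes K :: "'i \<Rightarrow> 'i \<Rightarrow> real"
  assumes "finite I"
  shows "\<exists>\<xi> :: 'i \<Rightarrow> real. (\<forall>i. \<xi> i = 1 \<or> \<xi> i = -1) \<and>
    (\<Sum>i\<in>I. K i i) \<le> (\<Sum>i\<in>I. \<Sum>j\<in>I. \<xi> i * \<xi> j * K i j)"
  using assms
proof (induction I rule: finite_induct)
  case empty
  show ?case by (rule exI[of _ "\<lambda>_. 1"]) auto
next
  case (insert a I)
  then obtain \<xi> :: "'i \<Rightarrow> real" where \<xi>: "\<And>i. \<xi> i = 1 \<or> \<xi> i = -1"
    "(\<Sum>i\<in>I. K i i) \<le> (\<Sum>i\<in>I. \<Sum>j\<in>I. \<xi> i * \<xi> j * K i j)" by blast
  \<comment> \<open>The coefficient of the new sign in the quadratic form; giving \<open>a\<close>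
    the sign of \<open>c\<close> makes this contribution nonnegative.\<close>
  define c where "c = (\<Sum>i\<in>I. \<xi> i * (K a i + K i a))"
  define \<xi>' where "\<xi>' = \<xi>(a := if c \<ge> 0 then 1 else -1)"
  have ne: "i \<noteq> a" if "i \<in> I" for i using insert.hyps that by auto
  have "(\<Sum>i\<in>insert a I. \<Sum>j\<in>insert a I. \<xi>' i * \<xi>' j * K i j)
    = \<xi>' a * \<xi>' a * K a a + (\<Sum>j\<in>I. \<xi>' a * \<xi>' j * K a j) + (\<Sum>i\<in>I. \<xi>' i * \<xi>' a * K i a)
      + (\<Sum>i\<in>I. \<Sum>j\<in>I. \<xi>' i * \<xi>' j * K i j)"
    using insert.hyps by (simp add: sum.distrib)
  also have "(\<Sum>j\<in>I. \<xi>' a * \<xi>' j * K a j) = \<xi>' a * (\<Sum>j\<in>I. \<xi> j * K a j)"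
    unfolding sum_distrib_left by (intro sum.cong refl) (auto simp: \<xi>'_def ne)
  also have "(\<Sum>i\<in>I. \<xi>' i * \<xi>' a * K i a) = \<xi>' a * (\<Sum>i\<in>I. \<xi> i * K i a)"
    unfolding sum_distrib_left by (intro sum.cong refl) (auto simp: \<xi>'_def ne)
  also have "(\<Sum>i\<in>I. \<Sum>j\<in>I. \<xi>' i * \<xi>' j * K i j) = (\<Sum>i\<in>I. \<Sum>j\<in>I. \<xi> i * \<xi> j * K i j)"
    by (intro sum.cong refl) (auto simp: \<xi>'_def ne)
  finally have "(\<Sum>i\<in>insert a I. \<Sum>j\<in>insert a I. \<xi>' i * \<xi>' j * K i j)
      = K a a + \<xi>' a * c + (\<Sum>i\<in>I. \<Sum>j\<in>I. \<xi> i * \<xi> j * K i j)"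
    by (auto simp: c_def \<xi>'_def sum.distrib algebra_simps)
  moreover have "\<xi>' a * c \<ge> 0" by (auto simp: \<xi>'_def)
  ultimately have "(\<Sum>i\<in>insert a I. K i i) \<le> (\<Sum>i\<in>insert a I. \<Sum>j\<in>insert a I. \<xi>' i * \<xi>' j * K i j)"
    using \<xi>(2) insert.hyps by simp
  moreover have "\<xi>' i = 1 \<or> \<xi>' i = -1" for i using \<xi>(1)[of i] by (auto simp: \<xi>'_def)
  ultimately show ?case by blast
qed

text \<open>One sign per cluster: applying the previous lemma to the block sums of \<open>k\<close>,
  the diagonal consists of exactly the pairs within one cluster.\<close>

lemma exists_block_signs:
  fixes k :: "'a \<Rightarrow> 'a \<Rightarrow> real" and cl :: "'a \<Rightarrow> 'i"
  assumes "finite V"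
  shows "\<exists>\<xi> :: 'i \<Rightarrow> real. (\<forall>i. \<xi> i = 1 \<or> \<xi> i = -1) \<and>
    (\<Sum>u\<in>V. \<Sum>v\<in>V. if cl u = cl v then k u v else 0)
      \<le> (\<Sum>u\<in>V. \<Sum>v\<in>V. \<xi> (cl u) * \<xi> (cl v) * k u v)"
proof -
  define K where "K i j = (\<Sum>u\<in>{u \<in> V. cl u = i}. \<Sum>v\<in>{v \<in> V. cl v = j}. k u v)" for i j
  have grp: "(\<Sum>i\<in>cl ` V. sum h {u \<in> V. cl u = i}) = sum h V" for h :: "'a \<Rightarrow> real"
    using assms by (intro sum.group) auto
  obtain \<xi> :: "'i \<Rightarrow> real" where \<xi>: "\<And>i. \<xi> i = 1 \<or> \<xi> i = -1"
    "(\<Sum>i\<in>cl ` V. K i i) \<le> (\<Sum>i\<in>cl ` V. \<Sum>j\<in>cl ` V. \<xi> i * \<xi> j * K i j)"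
    using exists_signs[of "cl ` V" K] assms by auto
  have "(\<Sum>i\<in>cl ` V. K i i)
      = (\<Sum>i\<in>cl ` V. \<Sum>u\<in>{u \<in> V. cl u = i}. \<Sum>v\<in>V. if cl u = cl v then k u v else 0)"
    unfolding K_def sum.inter_filter[OF assms, of _ "\<lambda>v. cl v = _"]
    by (rule sum.cong[OF refl], rule sum.cong[OF refl]) (auto intro!: sum.cong)
  also have "\<dots> = (\<Sum>u\<in>V. \<Sum>v\<in>V. if cl u = cl v then k u v else 0)" by (rule grp)
  finally have 1: "(\<Sum>i\<in>cl ` V. K i i) = (\<Sum>u\<in>V. \<Sum>v\<in>V. if cl u = cl v then k u v else 0)" .
  have "(\<Sum>i\<in>cl ` V. \<Sum>j\<in>cl ` V. \<xi> i * \<xi> j * K i j)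
    = (\<Sum>i\<in>cl ` V. \<Sum>j\<in>cl ` V. \<Sum>u\<in>{u \<in> V. cl u = i}. \<Sum>v\<in>{v \<in> V. cl v = j}. \<xi> (cl u) * \<xi> (cl v) * k u v)"
    unfolding K_def sum_distrib_left by (intro sum.cong refl) auto
  also have "\<dots> = (\<Sum>i\<in>cl ` V. \<Sum>u\<in>{u \<in> V. cl u = i}. \<Sum>j\<in>cl ` V. \<Sum>v\<in>{v \<in> V. cl v = j}. \<xi> (cl u) * \<xi> (cl v) * k u v)"
    by (rule sum.cong[OF refl], rule sum.swap)
  also have "\<dots> = (\<Sum>u\<in>V. \<Sum>v\<in>V. \<xi> (cl u) * \<xi> (cl v) * k u v)"
    unfolding grp ..
  finally show ?thesis using \<xi> 1 by (intro exI[of _ \<xi>]) auto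
qed

section \<open>Cuts as quadratic forms in signs, and the gain of a nearly balanced part\<close>

lemma sum_ordered_pairs:
  fixes g :: "'a set \<Rightarrow> real"
  assumes "finite V" "H \<subseteq> all_edges V"
  shows "(\<Sum>u\<in>V. \<Sum>v\<in>V. if {u, v} \<in> H then g {u, v} else 0) = 2 * (\<Sum>e\<in>H. g e)"
proof -
  have fin: "finite H" using assms finite_edge_set by blast
  have "(\<Sum>u\<in>V. \<Sum>v\<in>V. if {u, v} \<in> H then g {u, v} else 0)
      = (\<Sum>p\<in>V \<times> V. if {fst p, snd p} \<in> H then g {fst p, snd p} else 0)"
    by (simp add: sum.cartesian_product case_prod_beta)
  also have "\<dots> = (\<Sum>p\<in>V \<times> V. \<Sum>e\<in>H. if e = {fst p, snd p} then g e else 0)"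
    using fin by (intro sum.cong refl) (simp add: sum.delta)
  also have "\<dots> = (\<Sum>e\<in>H. \<Sum>p\<in>V \<times> V. if e = {fst p, snd p} then g e else 0)"
    by (rule sum.swap)
  also have "\<dots> = (\<Sum>e\<in>H. 2 * g e)"
  proof (intro sum.cong refl)
    fix e assume "e \<in> H"
    then obtain x y where e: "e = {x, y}" "x \<noteq> y" "x \<in> V" "y \<in> V"
      using assms(2) by (meson all_edgesE subsetD)
    have "(\<Sum>p\<in>V \<times> V. if e = {fst p, snd p} then g e else 0)
        = (\<Sum>p\<in>{(x, y), (y, x)}. g e)"
      using assms(1) e by (intro sum.mono_neutral_cong_right) (auto simp: doubleton_eq_iff)
    then show "(\<Sum>p\<in>V \<times> V. if e = {fst p, snd p} then g e else 0) = 2 * g e"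
      using e by simp
  qed
  finally show ?thesis by (simp add: sum_distrib_left)
qed

text \<open>Here \<open>t\<close> measures the imbalance of \<open>A\<close>. The main term is
  \<open>n\<^sup>2\<close> times the excess of the cut over \<open>M / 2 + n / 4\<close>. The free
  parameter \<open>\<tau>\<close> turns the error linear in \<open>t\<close> into one in
  \<open>t\<^sup>2\<close>, which a quadratic form can penalise.\<close>

lemma part_gain_ge:
  fixes V :: "'a set" and \<tau> :: real
  assumes "finite V" "H \<subseteq> all_edges V" "A \<subseteq> V" "\<tau> > 0" "V \<noteq> {}"
  defines "n \<equiv> real (card V)" and "M \<equiv> real (card H)" and "t \<equiv> real (card A) - real (card V) / 2"
    and "x \<equiv> real (cut H A (V - A))"
  shows "part_gain V (all_edges V - H) A
     \<ge> n\<^sup>2 * (x - M / 2 - n / 4) - (2 + 1 / \<tau>) * M * t\<^sup>2 - \<tau> * n\<^sup>2 * M - M\<^sup>2"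
proof -
  define a b \<alpha> \<beta> where d: "a = real (card A)" "b = real (card (V - A))"
    "\<alpha> = real (edges_within H A)" "\<beta> = real (edges_within H (V - A))"
  have pos: "a \<ge> 0" "b \<ge> 0" "\<alpha> \<ge> 0" "\<beta> \<ge> 0" "x \<ge> 0" "M \<ge> 0" by (simp_all add: d x_def M_def)
  have n1: "n \<ge> 1" using assms by (simp add: n_def Suc_leI card_gt_0_iff)
  have n: "n = a + b" using assms card_Diff_subset[of A V] card_mono[of V A] finite_subset[of A V]
    by (simp add: d n_def)
  have M: "M = \<alpha> + \<beta> + x" using card_edges_split[OF assms(1-3)] by (simp add: d x_def M_def)
  have ab: "a = n / 2 + t" "b = n / 2 - t" using n by (simp_all add: t_def d n_def)
  have "part_gain V (all_edges V - H) A
      = a * b * (2 * M - (n - 1)) - 2 * (n - 1) * (a * \<beta> + b * \<alpha>) + 4 * \<alpha> * \<beta> - x ^ 2"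
    using part_gain_complement[OF assms(1-3)] by (simp add: d x_def M_def n_def)
  moreover have "a * b * (2 * M - (n - 1)) \<ge> n\<^sup>2 / 4 * (2 * M - n) - 2 * M * t\<^sup>2"
  proof -
    \<comment> \<open>This uses \<open>a * b = n\<^sup>2 / 4 - t\<^sup>2\<close>.\<close>
    have "a * b * (2 * M - (n - 1)) = a * b + (n\<^sup>2 / 4 * (2 * M - n) - 2 * M * t\<^sup>2) + n * t\<^sup>2"
      unfolding ab by (simp add: power2_eq_square field_simps)
    moreover have "a * b \<ge> 0" "n * t\<^sup>2 \<ge> 0" using pos n1 by auto
    ultimately show ?thesis by linarith
  qed
  moreover have "2 * (n - 1) * (a * \<beta> + b * \<alpha>) \<le> n\<^sup>2 * (M - x) + \<tau> * n\<^sup>2 * M + t\<^sup>2 / \<tau> * M"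
  proof -
    have "2 * (n - 1) * (a * \<beta> + b * \<alpha>) \<le> 2 * n * (a * \<beta> + b * \<alpha>)"
      using pos by (intro mult_right_mono) auto
    also have "\<dots> = n\<^sup>2 * (M - x) + 2 * n * (t * (\<beta> - \<alpha>))"
      unfolding ab M by (simp add: power2_eq_square field_simps)
    also have "t * (\<beta> - \<alpha>) \<le> \<bar>t\<bar> * M"
    proof -
      have "t * (\<beta> - \<alpha>) \<le> \<bar>t\<bar> * \<bar>\<beta> - \<alpha>\<bar>" by (metis abs_ge_self abs_mult)
      also have "\<dots> \<le> \<bar>t\<bar> * M" using pos M by (intro mult_left_mono) auto
      finally show ?thesis .
    qed
    also have "2 * n * (\<bar>t\<bar> * M) \<le> (\<tau> * n\<^sup>2 + t\<^sup>2 / \<tau>) * M"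
    proof -
      \<comment> \<open>Weighted inequality of arithmetic and geometric means for \<open>n\<close>
        and \<open>\<bar>t\<bar>\<close>.\<close>
      have "0 \<le> (\<tau> * n - \<bar>t\<bar>)\<^sup>2 / \<tau>" using assms(4) by simp
      also have "\<dots> = \<tau> * n\<^sup>2 + t\<^sup>2 / \<tau> - 2 * n * \<bar>t\<bar>"
        using assms(4) by (simp add: power2_eq_square field_simps)
      finally have "2 * n * \<bar>t\<bar> * M \<le> (\<tau> * n\<^sup>2 + t\<^sup>2 / \<tau>) * M"
        using pos by (intro mult_right_mono) auto
      then show ?thesis by (simp add: mult.assoc)
    qed
    finally show ?thesis using n1 by (simp add: algebra_simps)
  qed
  moreover have "x\<^sup>2 \<le> M\<^sup>2" using pos M by (intro power_mono) auto
  moreover have "4 * \<alpha> * \<beta> \<ge> 0" using pos by simp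
  moreover have "n\<^sup>2 * (x - M / 2 - n / 4) - (2 + 1 / \<tau>) * M * t\<^sup>2 - \<tau> * n\<^sup>2 * M - M\<^sup>2
     = (n\<^sup>2 / 4 * (2 * M - n) - 2 * M * t\<^sup>2) - (n\<^sup>2 * (M - x) + \<tau> * n\<^sup>2 * M + t\<^sup>2 / \<tau> * M) - M\<^sup>2"
    using assms(4) by (simp add: field_simps)
  ultimately show ?thesis by linarith
qed

text \<open>The product of the signs on an edge is -1 exactly when the edge crosses, so maximising
  the cut means minimising this sum.\<close>

lemma sum_edges_prod_signs:
  fixes \<sigma> :: "'a \<Rightarrow> real"
  assumes "finite V" "H \<subseteq> all_edges V" "\<And>v. \<sigma> v = 1 \<or> \<sigma> v = -1"
  defines "A \<equiv> {v \<in> V. \<sigma> v = 1}"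
  shows "(\<Sum>e\<in>H. \<Prod>v\<in>e. \<sigma> v) = real (card H) - 2 * real (cut H A (V - A))"
proof -
  have fin: "finite H" using assms finite_edge_set by blast
  have "(\<Prod>v\<in>e. \<sigma> v) = 1 - 2 * (if \<not> e \<subseteq> A \<and> \<not> e \<subseteq> V - A then 1 else 0)" if "e \<in> H" for e
  proof -
    obtain x y where e: "e = {x, y}" "x \<noteq> y" "x \<in> V" "y \<in> V"
      using assms(2) \<open>e \<in> H\<close> by (meson all_edgesE subsetD)
    show ?thesis using e(2-4) assms(3)[of x] assms(3)[of y] unfolding e(1) A_def by auto
  qed
  then have "(\<Sum>e\<in>H. \<Prod>v\<in>e. \<sigma> v) = (\<Sum>e\<in>H. 1 - 2 * (if \<not> e \<subseteq> A \<and> \<not> e \<subseteq> V - A then 1 else 0))"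
    by (intro sum.cong) auto
  also have "\<dots> = real (card H) - 2 * real (cut H A (V - A))"
    using fin by (simp add: sum_subtractf sum.If_cases Int_def cut_def flip: sum_distrib_left)
  finally show ?thesis .
qed

lemma sum_sum_linear:
  fixes f h :: "'a \<Rightarrow> 'b \<Rightarrow> real"
  shows "(\<Sum>u\<in>U. \<Sum>v\<in>V. c * f u v - d * h u v)
    = c * (\<Sum>u\<in>U. \<Sum>v\<in>V. f u v) - d * (\<Sum>u\<in>U. \<Sum>v\<in>V. h u v)"
  by (simp add: sum_subtractf sum_distrib_left)

text \<open>The components of \<open>F\<close> are the clusters, coloured so that all edges of
  \<open>F\<close> other than bad ones are cut. Clusters are then flipped by signs chosen for one
  kernel that rewards cut edges of \<open>H\<close> and penalises imbalance at the same time. Only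
  pairs within clusters enter the guarantee: there a bad edge of \<open>F\<close> may contribute -1
  instead of 1, hence the factor 2.\<close>

lemma exists_part_gain_ge:
  fixes V :: "'a set" and \<tau> :: real
  assumes "finite V" "H \<subseteq> all_edges V" "F \<subseteq> H" "\<tau> > 0" "V \<noteq> {}"
  defines "n \<equiv> real (card V)" and "M \<equiv> real (card H)"
  shows "\<exists>A\<subseteq>V. part_gain V (all_edges V - H) A
     \<ge> n\<^sup>2 * ((real (card F) - 2 * real (card (bad_edges F H))) / 2 - n / 4)
        - (2 + 1 / \<tau>) * (M / 4) * real (card (linked_pairs V F)) - \<tau> * n\<^sup>2 * M - M\<^sup>2"
proof -
  \<comment> \<open>Chosen so that the penalty \<open>4 * \<kappa> * t\<^sup>2\<close> equals the
    \<open>t\<^sup>2\<close> error in \<open>part_gain_ge\<close>.\<close>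
  define \<kappa> where "\<kappa> = (2 + 1 / \<tau>) * (M / 4)"
  have \<kappa>0: "\<kappa> \<ge> 0" using assms(4) by (simp add: \<kappa>_def M_def)
  let ?R = "(adj F)\<^sup>*"
  let ?B = "F - bad_edges F H"
  have finH: "finite H" using assms finite_edge_set by blast
  have finF: "finite F" using finH assms(3) finite_subset by blast
  \<comment> \<open>An edge of \<open>F\<close> that is not bad is a bridge of \<open>F\<close>,
    hence also of the smaller graph \<open>?B\<close>.\<close>
  have "\<exists>s :: 'a \<Rightarrow> real. (\<forall>v. s v = 1 \<or> s v = -1) \<and> (\<forall>u v. {u, v} \<in> ?B \<longrightarrow> s u * s v = -1)"
  proof (rule bridges_two_colouring)
    show "finite ?B" using finF by simp
    show "(u, v) \<notin> (adj (?B - {{u, v}}))\<^sup>*" if "{u, v} \<in> ?B" for u v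
      using that assms(3) adj_rtrancl_mono[of "?B - {{u, v}}" "F - {{u, v}}"]
      by (auto simp: bad_edges_def)
  qed
  then obtain s :: "'a \<Rightarrow> real" where s: "\<And>v. s v = 1 \<or> s v = -1"
    "\<And>u v. {u, v} \<in> ?B \<Longrightarrow> s u * s v = -1" by blast
  define cl where "cl u = ?R `` {u}" for u
  have cl: "cl u = cl v \<longleftrightarrow> (u, v) \<in> ?R" for u v
    unfolding cl_def using eq_equiv_class_iff[OF equiv_adj_rtrancl[of F], of u v] by simp
  \<comment> \<open>The weight \<open>n\<^sup>2 / 4\<close> becomes \<open>n\<^sup>2 / 2\<close> per
    edge, as both orders of its ends are summed. Together with \<open>\<sigma>\<close> the double
    sum is the cut term minus \<open>\<kappa>\<close> times the squared sum of signs.\<close>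
  define k where "k u v = s u * s v * (- (n\<^sup>2 / 4) * (if {u, v} \<in> H then 1 else 0) - \<kappa>)" for u v
  obtain \<xi> :: "'a set \<Rightarrow> real" where \<xi>: "\<And>i. \<xi> i = 1 \<or> \<xi> i = -1"
    "(\<Sum>u\<in>V. \<Sum>v\<in>V. if cl u = cl v then k u v else 0)
      \<le> (\<Sum>u\<in>V. \<Sum>v\<in>V. \<xi> (cl u) * \<xi> (cl v) * k u v)"
    using exists_block_signs[OF assms(1), of cl k] by blast
  define \<sigma> where "\<sigma> u = \<xi> (cl u) * s u" for u
  have \<sigma>: "\<sigma> u = 1 \<or> \<sigma> u = -1" for u using \<xi>(1)[of "cl u"] s(1)[of u] by (auto simp: \<sigma>_def)
  define A where "A = {v \<in> V. \<sigma> v = 1}"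
  define t where "t = real (card A) - real (card V) / 2"
  have pr: "(\<Prod>w\<in>{u, v}. f w) = f u * f v" if "{u, v} \<in> H" for u v and f :: "'a \<Rightarrow> real"
    using that assms(2) doubleton_in_all_edges[of u v V] by auto
  have "(\<Sum>u\<in>V. \<sigma> u) = (\<Sum>u\<in>V. 2 * (if \<sigma> u = 1 then 1 else 0) - 1)"
    using \<sigma> by (intro sum.cong) auto
  also have "\<dots> = 2 * t"
    using assms(1) by (simp add: sum_subtractf sum.If_cases Int_def A_def t_def flip: sum_distrib_left)
  finally have sum\<sigma>: "(\<Sum>u\<in>V. \<sigma> u) = 2 * t" .
  have "(\<Sum>u\<in>V. \<Sum>v\<in>V. \<xi> (cl u) * \<xi> (cl v) * k u v)
      = (\<Sum>u\<in>V. \<Sum>v\<in>V. - (n\<^sup>2 / 4) * (if {u, v} \<in> H then \<Prod>w\<in>{u, v}. \<sigma> w else 0)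
           - \<kappa> * (\<sigma> u * \<sigma> v))"
  proof (intro sum.cong refl)
    fix u v
    show "\<xi> (cl u) * \<xi> (cl v) * k u v = - (n\<^sup>2 / 4) * (if {u, v} \<in> H then \<Prod>w\<in>{u, v}. \<sigma> w else 0)
        - \<kappa> * (\<sigma> u * \<sigma> v)"
      by (cases "{u, v} \<in> H") (simp_all add: k_def \<sigma>_def pr field_simps del: prod.insert)
  qed
  also have "\<dots> = - (n\<^sup>2 / 4) * (\<Sum>u\<in>V. \<Sum>v\<in>V. if {u, v} \<in> H then \<Prod>w\<in>{u, v}. \<sigma> w else 0)
      - \<kappa> * ((\<Sum>u\<in>V. \<sigma> u) * (\<Sum>v\<in>V. \<sigma> v))"
    unfolding sum_product by (rule sum_sum_linear)
  also have "\<dots> = - (n\<^sup>2 / 2) * (M - 2 * real (cut H A (V - A))) - 4 * \<kappa> * t\<^sup>2"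
    using sum_edges_prod_signs[OF assms(1,2) \<sigma>]
    unfolding sum_ordered_pairs[OF assms(1,2)] sum\<sigma> A_def M_def by (simp add: power2_eq_square)
  finally have up: "(\<Sum>u\<in>V. \<Sum>v\<in>V. \<xi> (cl u) * \<xi> (cl v) * k u v)
      = - (n\<^sup>2 / 2) * (M - 2 * real (cut H A (V - A))) - 4 * \<kappa> * t\<^sup>2" .
  \<comment> \<open>The sign product of an edge within a cluster; edges between clusters do not
    enter the diagonal blocks.\<close>
  define g where "g e = (if \<exists>u v. e = {u, v} \<and> (u, v) \<in> ?R then \<Prod>w\<in>e. s w else 0)" for e
  have gR: "g {u, v} = (if (u, v) \<in> ?R then \<Prod>w\<in>{u, v}. s w else 0)" for u v
    using symD[OF sym_adj_rtrancl, of v u F] unfolding g_def by (auto simp: doubleton_eq_iff)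
  have "(\<Sum>u\<in>V. \<Sum>v\<in>V. if cl u = cl v then k u v else 0)
     = (\<Sum>u\<in>V. \<Sum>v\<in>V. - (n\<^sup>2 / 4) * (if {u, v} \<in> H then g {u, v} else 0)
          - \<kappa> * (if (u, v) \<in> ?R then s u * s v else 0))"
  proof (intro sum.cong refl)
    fix u v
    show "(if cl u = cl v then k u v else 0) = - (n\<^sup>2 / 4) * (if {u, v} \<in> H then g {u, v} else 0)
        - \<kappa> * (if (u, v) \<in> ?R then s u * s v else 0)"
      unfolding cl gR
      by (cases "{u, v} \<in> H") (simp_all add: k_def pr field_simps del: prod.insert)
  qed
  also have "\<dots> = - (n\<^sup>2 / 2) * (\<Sum>e\<in>H. g e)
      - \<kappa> * (\<Sum>u\<in>V. \<Sum>v\<in>V. if (u, v) \<in> ?R then s u * s v else 0)"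
    unfolding sum_sum_linear sum_ordered_pairs[OF assms(1,2), of g] by simp
  also have "\<dots> \<ge> n\<^sup>2 / 2 * (real (card F) - 2 * real (card (bad_edges F H)))
      - \<kappa> * real (card (linked_pairs V F))"
  proof -
    \<comment> \<open>Edges of \<open>F\<close> that are not bad are cut and give -1; edges of
      \<open>H - F\<close> that are not bad join different clusters and give 0; a bad edge gives at
      most 1, whether or not it lies in \<open>F\<close>.\<close>
    have "g e \<le> 2 * (if e \<in> bad_edges F H then 1 else 0) - (if e \<in> F then 1 else 0)"
      if "e \<in> H" for e
    proof -
      obtain x y where e: "e = {x, y}" "x \<noteq> y" "x \<in> V" "y \<in> V"
        using assms(2) \<open>e \<in> H\<close> by (meson all_edgesE subsetD)
      have g1: "g e \<le> 1" using s(1)[of x] s(1)[of y] e by (auto simp: gR)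
      show ?thesis
      proof (cases "e \<in> bad_edges F H")
        case True
        then show ?thesis using g1 by simp
      next
        case nbad: False
        show ?thesis
        proof (cases "e \<in> F")
          case True
          then have "(x, y) \<in> ?R" using e(1) by (auto simp: adj_def)
          then show ?thesis using True nbad s(2)[of x y] e by (auto simp: gR)
        next
          case False
          then have "F - {e} = F" by auto
          then have "(x, y) \<notin> ?R" using nbad \<open>e \<in> H\<close> e(1) by (auto simp: bad_edges_def)
          then show ?thesis using False nbad e(1) by (simp add: gR)
        qed
      qed
    qed
    then have "(\<Sum>e\<in>H. g e)
        \<le> (\<Sum>e\<in>H. 2 * (if e \<in> bad_edges F H then 1 else 0) - (if e \<in> F then 1 else 0))"
      by (rule sum_mono)
    also have "\<dots> = 2 * real (card (bad_edges F H)) - real (card F)"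
    proof -
      have "H \<inter> bad_edges F H = bad_edges F H" "H \<inter> F = F"
        using assms(3) by (auto simp: bad_edges_def)
      then show ?thesis using finH
        by (simp add: sum_subtractf sum.If_cases flip: sum_distrib_left)
    qed
    finally have 1: "(\<Sum>e\<in>H. g e) \<le> 2 * real (card (bad_edges F H)) - real (card F)" .
    have "(\<Sum>u\<in>V. \<Sum>v\<in>V. if (u, v) \<in> ?R then s u * s v else 0)
        \<le> (\<Sum>u\<in>V. \<Sum>v\<in>V. if (u, v) \<in> ?R then 1 else 0)"
    proof (intro sum_mono)
      fix u v
      show "(if (u, v) \<in> ?R then s u * s v else 0) \<le> (if (u, v) \<in> ?R then 1 else 0)"
        using s(1)[of u] s(1)[of v] by auto
    qed
    also have "\<dots> = real (card (linked_pairs V F))"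
    proof -
      have eq: "linked_pairs V F = V \<times> V \<inter> {p. p \<in> ?R}" by (auto simp: linked_pairs_def)
      show ?thesis using assms(1) unfolding sum.cartesian_product eq
        by (simp add: sum.If_cases case_prod_beta)
    qed
    finally have 2: "(\<Sum>u\<in>V. \<Sum>v\<in>V. if (u, v) \<in> ?R then s u * s v else 0)
        \<le> real (card (linked_pairs V F))" .
    have "n\<^sup>2 / 2 * (\<Sum>e\<in>H. g e) \<le> n\<^sup>2 / 2 * (2 * real (card (bad_edges F H)) - real (card F))"
      by (rule mult_left_mono[OF 1]) simp
    with mult_left_mono[OF 2 \<kappa>0] show ?thesis by (simp add: algebra_simps)
  qed
  finally have low: "n\<^sup>2 / 2 * (real (card F) - 2 * real (card (bad_edges F H)))
      - \<kappa> * real (card (linked_pairs V F)) \<le> (\<Sum>u\<in>V. \<Sum>v\<in>V. if cl u = cl v then k u v else 0)" .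
  have A: "A \<subseteq> V" by (auto simp: A_def)
  have "part_gain V (all_edges V - H) A
     \<ge> n\<^sup>2 * (real (cut H A (V - A)) - M / 2 - n / 4) - (2 + 1 / \<tau>) * M * t\<^sup>2 - \<tau> * n\<^sup>2 * M - M\<^sup>2"
    using part_gain_ge[OF assms(1,2) A assms(4,5)] unfolding n_def M_def t_def .
  moreover have "4 * \<kappa> * t\<^sup>2 = (2 + 1 / \<tau>) * M * t\<^sup>2" by (simp add: \<kappa>_def)
  ultimately have "part_gain V (all_edges V - H) A
     \<ge> n\<^sup>2 * ((real (card F) - 2 * real (card (bad_edges F H))) / 2 - n / 4)
        - \<kappa> * real (card (linked_pairs V F)) - \<tau> * n\<^sup>2 * M - M\<^sup>2"
    using low \<xi>(2) unfolding up by (simp add: algebra_simps)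
  then show ?thesis using A by (auto simp: \<kappa>_def)
qed

text \<open>Both parts of the bipartition have the same gain, which doubles the
  contribution.\<close>

lemma modularity_ge_part_gain:
  assumes "finite V" "E \<subseteq> all_edges V" "E \<noteq> {}" "A \<subseteq> V" "0 < part_gain V E A"
  shows "part_gain V E A / (2 * real (card E) ^ 2) \<le> modularity V E"
proof -
  have "edges_within E {} = 0"
    using assms(2) by (auto simp: edges_within_def all_edges_def card_eq_0_iff)
  \<comment> \<open>Positive gain excludes the empty and the full set, so \<open>A\<close> and
    \<open>V - A\<close> are both nonempty and form a partition.\<close>
  then have "part_gain V E {} \<le> 0" "part_gain V E V \<le> 0" by (auto simp: part_gain_def)
  then have ne: "A \<noteq> {}" "A \<noteq> V" using assms(5) by auto
  have p: "partition_on V {A, V - A}" using ne assms(4) by (auto simp: partition_on_def disjoint_def)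
  have "V - (V - A) = A" using assms(4) by auto
  moreover have "cut E (V - A) A = cut E A (V - A)" by (simp add: cut_def conj_commute)
  ultimately have "part_gain V E (V - A) = part_gain V E A"
    by (simp add: part_gain_def)
  moreover have "A \<noteq> V - A" using ne assms(4) by blast
  ultimately have "modularity_of E {A, V - A} = 2 * part_gain V E A / (4 * real (card E) ^ 2)"
    unfolding modularity_of_eq_part_gain[OF assms(1-3) p] by simp
  then show ?thesis using modularity_ge[OF assms(1,3) p] by simp
qed

section \<open>Paths as vertex lists, and paths through pendant edges\<close>

fun path_edges :: "'a list \<Rightarrow> 'a set set" where
  "path_edges (x # y # zs) = insert {x, y} (path_edges (y # zs))"
| "path_edges _ = {}"

lemma path_edges_append:
  "path_edges (xs @ y # zs) = path_edges (xs @ [y]) \<union> path_edges (y # zs)"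
proof (induction xs)
  case (Cons x xs)
  then show ?case by (cases xs) auto
qed simp

lemma path_edges_subset: "e \<in> path_edges xs \<Longrightarrow> e \<subseteq> set xs"
  by (induction xs rule: path_edges.induct) auto

lemma finite_path_edges: "finite (path_edges xs)"
  by (induction xs rule: path_edges.induct) auto

lemma card_path_edges: "distinct xs \<Longrightarrow> card (path_edges xs) = length xs - 1"
proof (induction xs rule: path_edges.induct)
  case (1 x y zs)
  have "{x, y} \<notin> path_edges (y # zs)" using 1 path_edges_subset[of "{x, y}" "y # zs"] by auto
  then show ?case using 1 by (simp add: finite_path_edges)
qed auto

lemma path_edges_split: "e \<in> path_edges xs \<Longrightarrow> \<exists>p x y r. xs = p @ x # y # r \<and> e = {x, y}"
proof (induction xs rule: path_edges.induct)
  case (1 x y zs)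
  show ?case
  proof (cases "e = {x, y}")
    case True
    then show ?thesis by (metis append_Nil)
  next
    case False
    then obtain p x' y' r where "y # zs = p @ x' # y' # r" "e = {x', y'}" using 1 by auto
    then show ?thesis by (metis append_Cons)
  qed
qed auto

lemma path_edges_all_edges: "distinct xs \<Longrightarrow> set xs \<subseteq> V \<Longrightarrow> path_edges xs \<subseteq> all_edges V"
  by (induction xs rule: path_edges.induct) (auto simp: doubleton_in_all_edges)

text \<open>A path is extended step by step; if the new endpoint was visited before, the path is cut
  back to that visit.\<close>

lemma rtrancl_adj_path:
  assumes "(u, v) \<in> (adj F)\<^sup>*"
  shows "\<exists>xs. xs \<noteq> [] \<and> distinct xs \<and> hd xs = u \<and> last xs = v \<and> path_edges xs \<subseteq> F"
  using assms
proof (induction rule: rtrancl_induct)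
  case base
  show ?case by (rule exI[of _ "[u]"]) simp
next
  case (step y z)
  then obtain xs where xs: "xs \<noteq> []" "distinct xs" "hd xs = u" "last xs = y" "path_edges xs \<subseteq> F"
    by blast
  show ?case
  proof (cases "z \<in> set xs")
    case True
    then obtain p r where pr: "xs = p @ z # r" by (meson split_list)
    then have "path_edges (p @ [z]) \<subseteq> F" using xs(5) path_edges_append[of p z r] by auto
    then show ?thesis using xs pr by (intro exI[of _ "p @ [z]"]) (cases p; auto)
  next
    case False
    obtain p where p: "xs = p @ [y]" using xs(1,4) by (metis append_butlast_last_id)
    have "path_edges (xs @ [z]) \<subseteq> F"
      using xs(5) step(2) path_edges_append[of p y "[z]"] by (auto simp: p adj_def)
    then show ?thesis using xs False by (intro exI[of _ "xs @ [z]"]) auto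
  qed
qed

text \<open>This is the edge set \<open>P\<close> of the overview; \<open>v\<close> is an end of
  degree one.\<close>

definition pendant_edges :: "'a set set \<Rightarrow> 'a set set" where
  "pendant_edges H = {e \<in> H. \<exists>v\<in>e. \<forall>e'\<in>H. v \<in> e' \<longrightarrow> e' = e}"

text \<open>An edge strictly inside the path has a further edge of \<open>H\<close> at each of its
  ends, so neither end has degree one and the edge cannot be pendant.\<close>

lemma interior_path_edges:
  assumes "distinct (a # ys @ [b])" "path_edges (a # ys @ [b]) \<subseteq> H\<^sub>0 \<union> pendant_edges H" "H\<^sub>0 \<subseteq> H"
  shows "path_edges ys \<subseteq> H\<^sub>0"
proof
  fix e assume "e \<in> path_edges ys"
  then obtain p x y r where pr: "ys = p @ x # y # r" "e = {x, y}" by (meson path_edges_split)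
  \<comment> \<open>The vertices \<open>c\<close> before and \<open>d\<close> after the inner edge
    exist because \<open>a\<close> and \<open>b\<close> surround \<open>ys\<close>.\<close>
  obtain p' c where p': "a # p = p' @ [c]" by (metis append_butlast_last_id list.distinct(1))
  obtain d r' where r': "r @ [b] = d # r'" by (metis list.exhaust snoc_eq_iff_butlast)
  have eq: "a # ys @ [b] = p' @ c # x # y # d # r'" using pr p' r' by (metis append_Cons append_assoc append_Nil)
  have sub: "{{c, x}, {x, y}, {y, d}} \<subseteq> H\<^sub>0 \<union> pendant_edges H"
    using assms(2) unfolding eq path_edges_append[of p' c "x # y # d # r'"] by auto
  then have H: "{c, x} \<in> H" "{y, d} \<in> H" using assms(3) by (auto simp: pendant_edges_def)
  have ne: "{c, x} \<noteq> {x, y}" "{y, d} \<noteq> {x, y}"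
    using assms(1) unfolding eq by (auto simp: doubleton_eq_iff)
  have "{x, y} \<notin> pendant_edges H"
  proof
    assume "{x, y} \<in> pendant_edges H"
    then obtain v where "v = x \<or> v = y" and v: "\<And>e'. e' \<in> H \<Longrightarrow> v \<in> e' \<Longrightarrow> e' = {x, y}"
      by (auto simp: pendant_edges_def)
    then show False using v[OF H(1)] v[OF H(2)] ne by auto
  qed
  then show "e \<in> H\<^sub>0" using sub pr by auto
qed

text \<open>The set \<open>D\<close> allows two uses: with \<open>D\<close> empty for linked pairs,
  and with \<open>D\<close> a single edge for a cycle through that edge. The last hypothesis
  excludes the path consisting of one edge.\<close>

lemma connected_interior_path:
  assumes "(u, v) \<in> (adj (F - D))\<^sup>*" "u \<noteq> v" "F = H\<^sub>0 \<union> pendant_edges H" "H\<^sub>0 \<subseteq> H" "{u, v} \<in> D \<or> {u, v} \<notin> F"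
  shows "\<exists>ys. ys \<noteq> [] \<and> distinct (u # ys @ [v]) \<and> {u, hd ys} \<in> H \<and> {last ys, v} \<in> H \<and> path_edges ys \<subseteq> H\<^sub>0"
proof -
  obtain xs where xs: "xs \<noteq> []" "distinct xs" "hd xs = u" "last xs = v" "path_edges xs \<subseteq> F - D"
    using rtrancl_adj_path[OF assms(1)] by blast
  then obtain ys where ys: "xs = u # ys @ [v]"
    using assms(2) by (metis append_butlast_last_id hd_Cons_tl last_tl last.simps)
  have ne: "ys \<noteq> []" using xs(5) assms(5) ys by auto
  have sub: "path_edges (u # ys @ [v]) \<subseteq> F" using xs(5) ys by auto
  have FH: "F \<subseteq> H" using assms(3,4) by (auto simp: pendant_edges_def)
  obtain y zs where y: "ys = y # zs" using ne by (cases ys) auto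
  obtain zs' z where z: "ys = zs' @ [z]" using ne by (metis append_butlast_last_id)
  have "{u, hd ys} \<in> F" using sub by (simp add: y)
  moreover have "{last ys, v} \<in> F"
    using sub path_edges_append[of "u # zs'" z "[v]"] by (simp add: z)
  moreover have "path_edges ys \<subseteq> H\<^sub>0"
    using interior_path_edges[of u ys v H\<^sub>0 H] sub xs(2) ys assms(3,4) by simp
  ultimately show ?thesis using ne xs(2) ys FH by blast
qed

subsection \<open>The random labelling\<close>

lemma prob_Pi_pmf_Ball:
  assumes "finite K" "F \<subseteq> K"
  shows "measure_pmf.prob (Pi_pmf K d (\<lambda>_. D)) {l. \<forall>e\<in>F. l e \<in> B e}
    = (\<Prod>e\<in>F. measure_pmf.prob D (B e))"
proof -
  have eq: "{l. \<forall>e\<in>F. l e \<in> B e} = Pi K (\<lambda>e. if e \<in> F then B e else UNIV)"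
    using assms(2) by (auto simp: Pi_def split: if_splits)
  have "measure_pmf.prob (Pi_pmf K d (\<lambda>_. D)) {l. \<forall>e\<in>F. l e \<in> B e}
      = (\<Prod>e\<in>K. measure_pmf.prob D (if e \<in> F then B e else UNIV))"
    unfolding eq by (rule measure_Pi_pmf_Pi[OF assms(1)])
  also have "\<dots> = (\<Prod>e\<in>F. measure_pmf.prob D (B e))"
    using assms by (intro prod.mono_neutral_cong_right) auto
  finally show ?thesis .
qed

lemma card_eq_sum_indicator:
  "finite I \<Longrightarrow> real (card {i \<in> I. x \<in> A i}) = (\<Sum>i\<in>I. indicator (A i) x)"
  by (simp add: indicator_def sum.If_cases Int_def)

lemma integrable_indicator_pmf:
  "integrable (measure_pmf P) (indicator A :: _ \<Rightarrow> real)"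
  by (rule integrable_real_indicator) (auto simp: less_top[symmetric])

lemma expectation_card:
  assumes "finite I"
  shows "measure_pmf.expectation P (\<lambda>x. real (card {i \<in> I. x \<in> A i})) = (\<Sum>i\<in>I. measure_pmf.prob P (A i))"
  unfolding card_eq_sum_indicator[OF assms]
  by (subst Bochner_Integration.integral_sum) (auto simp: integrable_indicator_pmf)

lemma integrable_card:
  assumes "finite I"
  shows "integrable (measure_pmf P) (\<lambda>x. real (card {i \<in> I. x \<in> A i}))"
  unfolding card_eq_sum_indicator[OF assms]
  by (intro Bochner_Integration.integrable_sum integrable_indicator_pmf)

lemma Markov_card:
  assumes "finite I" "t > 0"
  shows "measure_pmf.prob P {x. t \<le> real (card {i \<in> I. x \<in> A i})}
    \<le> (\<Sum>i\<in>I. measure_pmf.prob P (A i)) / t"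
proof -
  have "measure_pmf.prob P {x \<in> space (measure_pmf P). t \<le> real (card {i \<in> I. x \<in> A i})}
    \<le> measure_pmf.expectation P (\<lambda>x. real (card {i \<in> I. x \<in> A i})) / t"
    by (rule integral_Markov_inequality_measure[where A = "{}"])
      (use assms integrable_card[OF assms(1)] in auto)
  then show ?thesis by (simp add: expectation_card[OF assms(1)])
qed

text \<open>The second moment of a count is the sum of joint probabilities over ordered pairs, so
  only pairwise estimates are required.\<close>

lemma Chebyshev_card:
  fixes P :: "'a pmf" and A :: "'i \<Rightarrow> 'a set"
  assumes "finite I" "t > 0"
  defines "\<mu> \<equiv> \<Sum>i\<in>I. measure_pmf.prob P (A i)"
  shows "measure_pmf.prob P {x. t \<le> \<bar>real (card {i \<in> I. x \<in> A i}) - \<mu>\<bar>}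
    \<le> ((\<Sum>i\<in>I. \<Sum>j\<in>I. measure_pmf.prob P (A i \<inter> A j)) - \<mu>\<^sup>2) / t\<^sup>2"
proof -
  let ?f = "\<lambda>x. real (card {i \<in> I. x \<in> A i})"
  have sq: "(?f x)\<^sup>2 = (\<Sum>i\<in>I. \<Sum>j\<in>I. indicator (A i \<inter> A j) x)" for x
    unfolding card_eq_sum_indicator[OF assms(1)] power2_eq_square sum_product
    by (simp add: indicator_inter_arith)
  have int: "integrable (measure_pmf P) (\<lambda>x. (?f x)\<^sup>2)"
    unfolding sq by (intro Bochner_Integration.integrable_sum integrable_indicator_pmf)
  have E2: "measure_pmf.expectation P (\<lambda>x. (?f x)\<^sup>2) = (\<Sum>i\<in>I. \<Sum>j\<in>I. measure_pmf.prob P (A i \<inter> A j))"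
    unfolding sq
    by (simp add: Bochner_Integration.integral_sum Bochner_Integration.integrable_sum
        integrable_indicator_pmf)
  have "measure_pmf.prob P {x \<in> space (measure_pmf P). t \<le> \<bar>?f x - measure_pmf.expectation P ?f\<bar>}
      \<le> measure_pmf.variance P ?f / t\<^sup>2"
    by (rule measure_pmf.Chebyshev_inequality) (use assms int in auto)
  also have "measure_pmf.variance P ?f = measure_pmf.expectation P (\<lambda>x. (?f x)\<^sup>2) - (measure_pmf.expectation P ?f)\<^sup>2"
    by (rule measure_pmf.variance_eq[OF integrable_card[OF assms(1)] int])
  finally show ?thesis
    unfolding E2 expectation_card[OF assms(1)] \<mu>_def by simp
qed

lemma card_ordered_pairs:
  assumes "finite V" "H \<subseteq> all_edges V"
  shows "card {p \<in> V \<times> V. {fst p, snd p} \<in> H} = 2 * card H"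
proof -
  have "real (card {p \<in> V \<times> V. {fst p, snd p} \<in> H}) = (\<Sum>p\<in>V \<times> V. if {fst p, snd p} \<in> H then 1 else 0)"
    using assms(1) by (simp add: sum.If_cases Int_def)
  also have "\<dots> = (\<Sum>u\<in>V. \<Sum>v\<in>V. if {u, v} \<in> H then 1 else 0)"
    by (simp add: sum.cartesian_product case_prod_beta)
  also have "\<dots> = 2 * real (card H)"
    using sum_ordered_pairs[OF assms, of "\<lambda>_. 1"] by simp
  finally show ?thesis by linarith
qed

text \<open>Labels couple the random graph with a thinned copy of its complement: one independent
  label per edge decides both memberships. The default \<open>d\<close> lies in \<open>S\<close> so
  that it is mapped to the default \<open>False\<close> of the binomial random graph.\<close>

locale edge_labelling =
  fixes n :: nat and D :: "'l pmf" and d :: 'l and S S\<^sub>0 :: "'l set" and q q\<^sub>0 :: real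
  assumes S\<^sub>0_subset: "S\<^sub>0 \<subseteq> S" and d_in: "d \<in> S"
    and prob_S: "measure_pmf.prob D S = q" and prob_S\<^sub>0: "measure_pmf.prob D S\<^sub>0 = q\<^sub>0"
begin

definition V :: "nat set" where
  "V = {1..n}"

lemma finite_V [simp]: "finite V" and card_V [simp]: "card V = n"
  by (simp_all add: V_def)

definition labels :: "(nat set \<Rightarrow> 'l) pmf" where
  "labels = Pi_pmf (all_edges V) d (\<lambda>_. D)"

text \<open>
  The labels outside \<open>S\<close> are the edges of the random graph, so \<open>hi l\<close> is its complement;
  \<open>lo l\<close> is the thinned copy \<open>H\<^sub>0\<close>.
\<close>

definition hi :: "(nat set \<Rightarrow> 'l) \<Rightarrow> nat set set" where
  "hi l = {e \<in> all_edges V. l e \<in> S}"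

definition lo :: "(nat set \<Rightarrow> 'l) \<Rightarrow> nat set set" where
  "lo l = {e \<in> all_edges V. l e \<in> S\<^sub>0}"

lemma q_bounds: "0 \<le> q\<^sub>0" "q\<^sub>0 \<le> q" "q \<le> 1"
  using S\<^sub>0_subset by (auto simp flip: prob_S prob_S\<^sub>0 intro: measure_pmf.finite_measure_mono)

lemma lo_subset_hi: "lo l \<subseteq> hi l"
  using S\<^sub>0_subset by (auto simp: lo_def hi_def)

lemma hi_subset: "hi l \<subseteq> all_edges V"
  by (auto simp: hi_def)

lemma prob_Diff: "measure_pmf.prob D (S - S\<^sub>0) = q - q\<^sub>0"
  using measure_pmf.finite_measure_Diff[of S D S\<^sub>0] S\<^sub>0_subset by (simp add: prob_S prob_S\<^sub>0)

lemma prob_Compl: "measure_pmf.prob D (- S) = 1 - q"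
  using measure_pmf.prob_compl[of S D] by (simp add: prob_S Compl_eq_Diff_UNIV)

lemma binomial_random_graph_eq:
  "binomial_random_graph n (1 - q) = map_pmf (\<lambda>l. all_edges V - hi l) labels"
proof -
  have b: "map_pmf (\<lambda>x. x \<notin> S) D = bernoulli_pmf (1 - q)"
  proof (rule pmf_eqI)
    fix i
    have "(\<lambda>x. x \<notin> S) -` {i} = (if i then - S else S)" by auto
    then show "pmf (map_pmf (\<lambda>x. x \<notin> S) D) i = pmf (bernoulli_pmf (1 - q)) i"
      using q_bounds prob_Compl prob_S by (cases i) (auto simp: pmf_map)
  qed
  have "Pi_pmf (all_edges V) False (\<lambda>_. bernoulli_pmf (1 - q))
      = map_pmf (\<lambda>h. (\<lambda>x. x \<notin> S) \<circ> h) labels"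
    unfolding b[symmetric] labels_def
    by (rule Pi_pmf_map) (use d_in finite_all_edges[of V] in auto)
  then show ?thesis
    unfolding binomial_random_graph_def V_def[symmetric]
    by (auto simp: map_pmf_comp hi_def intro!: map_pmf_cong)
qed

lemma prob_labels_Ball:
  "F \<subseteq> all_edges V \<Longrightarrow> measure_pmf.prob labels {l. \<forall>e\<in>F. l e \<in> B e}
    = (\<Prod>e\<in>F. measure_pmf.prob D (B e))"
  unfolding labels_def by (rule prob_Pi_pmf_Ball) (simp_all add: finite_all_edges)

lemma prob_labels_two:
  assumes "F \<subseteq> all_edges V" "T \<subseteq> F"
  shows "measure_pmf.prob labels {l. \<forall>e\<in>F. l e \<in> (if e \<in> T then B else C)}
    = measure_pmf.prob D B ^ card T * measure_pmf.prob D C ^ (card F - card T)"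
proof -
  have finF: "finite F" using finite_edge_set[of V F] assms(1) by auto
  have fin: "finite T" using finite_subset[OF assms(2) finF] .
  have "measure_pmf.prob labels {l. \<forall>e\<in>F. l e \<in> (if e \<in> T then B else C)}
      = (\<Prod>e\<in>F. measure_pmf.prob D (if e \<in> T then B else C))"
    by (rule prob_labels_Ball[OF assms(1)])
  also have "\<dots> = (\<Prod>e\<in>F. if e \<in> T then measure_pmf.prob D B else measure_pmf.prob D C)"
    by (intro prod.cong) auto
  also have "\<dots> = measure_pmf.prob D B ^ card (F \<inter> T) * measure_pmf.prob D C ^ card (F \<inter> - T)"
    using finF by (simp add: prod.If_cases)
  also have "F \<inter> T = T" using assms by auto
  also have "F \<inter> - T = F - T" by auto
  finally show ?thesis using card_Diff_subset[OF fin assms(2)] by simp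
qed

lemma prob_hi_lo:
  assumes "F\<^sub>1 \<subseteq> all_edges V" "F\<^sub>0 \<subseteq> all_edges V" "F\<^sub>1 \<inter> F\<^sub>0 = {}"
  shows "measure_pmf.prob labels {l. F\<^sub>1 \<subseteq> hi l \<and> F\<^sub>0 \<subseteq> lo l} = q ^ card F\<^sub>1 * q\<^sub>0 ^ card F\<^sub>0"
proof -
  have fin: "finite F\<^sub>1" "finite F\<^sub>0" using finite_edge_set[of V] assms by auto
  have "{l. F\<^sub>1 \<subseteq> hi l \<and> F\<^sub>0 \<subseteq> lo l} = {l. \<forall>e\<in>F\<^sub>1 \<union> F\<^sub>0. l e \<in> (if e \<in> F\<^sub>1 then S else S\<^sub>0)}"
    using assms by (auto simp: hi_def lo_def split: if_splits)
  moreover have "card (F\<^sub>1 \<union> F\<^sub>0) - card F\<^sub>1 = card F\<^sub>0"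
    using card_Un_disjoint[OF fin assms(3)] by simp
  ultimately show ?thesis
    using prob_labels_two[of "F\<^sub>1 \<union> F\<^sub>0" F\<^sub>1 S S\<^sub>0] assms by (simp add: prob_S prob_S\<^sub>0)
qed

text \<open>Distinct labels are independent, so the variance is at most the mean
  \<open>N * b\<close>. It is applied with \<open>S\<close> and with \<open>S\<^sub>0\<close> to
  count the edges of \<open>hi l\<close> and \<open>lo l\<close>.\<close>

lemma Chebyshev_label_count:
  fixes B :: "'l set"
  assumes "t > 0"
  defines "N \<equiv> real n * (real n - 1) / 2" and "b \<equiv> measure_pmf.prob D B"
  shows "measure_pmf.prob labels {l. t \<le> \<bar>real (card {e \<in> all_edges V. l e \<in> B}) - N * b\<bar>} \<le> N * b / t\<^sup>2"
proof -
  let ?K = "all_edges V"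
  have fin: "finite ?K" by (simp add: finite_all_edges)
  have N: "real (card ?K) = N" by (simp add: N_def card_all_edges of_nat_choose_two)
  have one: "measure_pmf.prob labels {l. l e \<in> B} = b" if "e \<in> ?K" for e
    using prob_labels_Ball[of "{e}" "\<lambda>_. B"] that by (simp add: b_def)
  have two: "measure_pmf.prob labels ({l. l e \<in> B} \<inter> {l. l e' \<in> B}) \<le> (if e = e' then b else 0) + b\<^sup>2"
    if "e \<in> ?K" "e' \<in> ?K" for e e'
  proof (cases "e = e'")
    case False
    have "{l. l e \<in> B} \<inter> {l. l e' \<in> B} = {l. \<forall>e\<in>{e, e'}. l e \<in> B}" by auto
    then show ?thesis using False prob_labels_Ball[of "{e, e'}" "\<lambda>_. B"] that
      by (simp add: b_def power2_eq_square)
  qed (use one that in auto)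
  have \<mu>: "(\<Sum>e\<in>?K. measure_pmf.prob labels {l. l e \<in> B}) = N * b"
    using one by (simp add: N)
  have "(\<Sum>e\<in>?K. \<Sum>e'\<in>?K. measure_pmf.prob labels ({l. l e \<in> B} \<inter> {l. l e' \<in> B}))
      \<le> (\<Sum>e\<in>?K. \<Sum>e'\<in>?K. (if e = e' then b else 0) + b\<^sup>2)"
    by (intro sum_mono two)
  also have "\<dots> = N * b + (N * b)\<^sup>2"
    using fin by (simp add: sum.distrib N power2_eq_square algebra_simps)
  finally have "(\<Sum>e\<in>?K. \<Sum>e'\<in>?K. measure_pmf.prob labels ({l. l e \<in> B} \<inter> {l. l e' \<in> B})) - (N * b)\<^sup>2 \<le> N * b"
    by simp
  then have "((\<Sum>e\<in>?K. \<Sum>e'\<in>?K. measure_pmf.prob labels ({l. l e \<in> B} \<inter> {l. l e' \<in> B})) - (N * b)\<^sup>2) / t\<^sup>2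
      \<le> N * b / t\<^sup>2"
    by (rule divide_right_mono) simp
  with Chebyshev_card[OF fin assms(1), of labels "\<lambda>e. {l. l e \<in> B}", unfolded \<mu>]
  show ?thesis by simp
qed

section \<open>Stars and the number of leaf edges outside the thinned copy\<close>

definition star :: "nat \<Rightarrow> nat set set" where
  "star v = {e \<in> all_edges V. v \<in> e}"

lemma star_eq: "v \<in> V \<Longrightarrow> star v = (\<lambda>u. {v, u}) ` (V - {v})"
  unfolding star_def by (auto simp: all_edges_def card_2_iff doubleton_eq_iff)

lemma finite_star: "finite (star v)"
  unfolding star_def by (simp add: finite_all_edges)

lemma star_subset: "star v \<subseteq> all_edges V"
  unfolding star_def by auto

lemma card_star: "v \<in> V \<Longrightarrow> card (star v) = n - 1"
  unfolding star_eq by (subst card_image) (auto simp: inj_on_def doubleton_eq_iff)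

lemma card_star_Un:
  assumes "v \<in> V" "v' \<in> V" "v \<noteq> v'"
  shows "card (star v \<union> star v') = 2 * n - 3"
proof -
  have "star v \<inter> star v' = {{v, v'}}"
    using assms by (auto simp: star_def all_edges_def card_2_iff)
  then have "card (star v \<union> star v') + 1 = 2 * (n - 1)"
    using card_Un_Int[OF finite_star finite_star, of v v'] card_star assms by simp
  then show ?thesis by linarith
qed

text \<open>The vertex \<open>v\<close> has degree one in \<open>hi l\<close> with neighbour
  \<open>w\<close>. Asking for \<open>S - S\<^sub>0\<close> rather than \<open>S\<close> ensures
  that the edge is new compared with \<open>lo l\<close>.\<close>

definition leaf_event :: "nat \<times> nat \<Rightarrow> (nat set \<Rightarrow> 'l) set" where
  "leaf_event = (\<lambda>(v, w). {l. \<forall>e\<in>star v. l e \<in> (if e \<in> {{v, w}} then S - S\<^sub>0 else - S)})"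

definition vertex_pairs :: "(nat \<times> nat) set" where
  "vertex_pairs = {(v, w). v \<in> V \<and> w \<in> V \<and> v \<noteq> w}"

lemma finite_vertex_pairs: "finite vertex_pairs"
  by (rule finite_subset[of _ "V \<times> V"]) (auto simp: vertex_pairs_def)

lemma card_vertex_pairs: "real (card vertex_pairs) = real n * (real n - 1)"
proof -
  have "vertex_pairs = V \<times> V - (\<lambda>v. (v, v)) ` V" by (auto simp: vertex_pairs_def)
  moreover have "card ((\<lambda>v. (v, v)) ` V) = n" by (subst card_image) (auto simp: inj_on_def)
  moreover have "(\<lambda>v. (v, v)) ` V \<subseteq> V \<times> V" by auto
  ultimately have "card vertex_pairs = n * n - n"
    using card_Diff_subset[of "(\<lambda>v. (v, v)) ` V" "V \<times> V"] by simp
  then show ?thesis by (cases n) (auto simp: algebra_simps)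
qed

text \<open>One edge at \<open>v\<close> has a label in \<open>S - S\<^sub>0\<close>; the other
  \<open>n - 2\<close> edges at \<open>v\<close> have labels outside \<open>S\<close>.\<close>

definition leaf_prob :: real where
  "leaf_prob = (q - q\<^sub>0) * (1 - q) ^ (n - 2)"

lemma prob_leaf_event:
  assumes "(v, w) \<in> vertex_pairs"
  shows "measure_pmf.prob labels (leaf_event (v, w)) = leaf_prob"
proof -
  have vw: "v \<in> V" "{v, w} \<in> star v"
    using assms by (auto simp: vertex_pairs_def star_def doubleton_in_all_edges)
  show ?thesis
    using prob_labels_two[OF star_subset, of "{{v, w}}" v "S - S\<^sub>0" "- S"] vw
    by (simp add: leaf_event_def prob_Diff prob_Compl leaf_prob_def card_star numeral_2_eq_2)
qed

text \<open>Two leaf events are nearly independent. They concern the same edge when the pairs agree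
  up to order, they are incompatible when a leaf of one is an end of the other in any other way, and
  otherwise their stars share only the edge \<open>{v, v'}\<close>.\<close>

lemma prob_leaf_event_Int:
  assumes "i \<in> vertex_pairs" "j \<in> vertex_pairs" "q < 1"
  shows "measure_pmf.prob labels (leaf_event i \<inter> leaf_event j)
    \<le> (if j = i then q else 0) + (if j = prod.swap i then q else 0) + leaf_prob\<^sup>2 / (1 - q)"
proof -
  obtain v w where i: "i = (v, w)" by (cases i)
  obtain v' w' where j: "j = (v', w')" by (cases j)
  have V: "v \<in> V" "w \<in> V" "v \<noteq> w" "v' \<in> V" "w' \<in> V" "v' \<noteq> w'"
    using assms by (auto simp: vertex_pairs_def i j)
  have nn: "0 \<le> leaf_prob\<^sup>2 / (1 - q)" using assms(3) by simp
  have st: "{v, w} \<in> star v" "{v', w'} \<in> star v'"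
    using V by (auto simp: star_def doubleton_in_all_edges)
  have in1: "l {v, w} \<in> S" if "l \<in> leaf_event i" for l
    using that st unfolding leaf_event_def i by auto
  have in2: "l {v', w'} \<in> S" if "l \<in> leaf_event j" for l
    using that st unfolding leaf_event_def j by auto
  have out1: "l {v, u} \<notin> S" if "l \<in> leaf_event i" "u \<in> V" "u \<noteq> v" "u \<noteq> w" for l u
  proof -
    have "{v, u} \<in> star v" "{v, u} \<noteq> {v, w}"
      using V that by (auto simp: star_def doubleton_in_all_edges doubleton_eq_iff)
    moreover from this(1) have "l {v, u} \<in> (if {v, u} \<in> {{v, w}} then S - S\<^sub>0 else - S)"
      using that(1) unfolding leaf_event_def i by blast
    ultimately show ?thesis by simp
  qed
  have out2: "l {v', u} \<notin> S" if "l \<in> leaf_event j" "u \<in> V" "u \<noteq> v'" "u \<noteq> w'" for l u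
  proof -
    have "{v', u} \<in> star v'" "{v', u} \<noteq> {v', w'}"
      using V that by (auto simp: star_def doubleton_in_all_edges doubleton_eq_iff)
    moreover from this(1) have "l {v', u} \<in> (if {v', u} \<in> {{v', w'}} then S - S\<^sub>0 else - S)"
      using that(1) unfolding leaf_event_def j by blast
    ultimately show ?thesis by simp
  qed
  \<comment> \<open>Two leaf edges at different vertices can only meet in a common neighbour, or coincide.\<close>
  consider (same) "j = i \<or> j = prod.swap i"
    | (empty) "\<not> (j = i \<or> j = prod.swap i)" "v = v' \<or> w = v' \<or> w' = v"
    | (indep) "v \<noteq> v'" "w \<noteq> v'" "w' \<noteq> v" by blast
  then show ?thesis
  proof cases
    case same
    have "measure_pmf.prob labels (leaf_event i \<inter> leaf_event j)
        \<le> measure_pmf.prob labels {l. \<forall>e\<in>{{v, w}}. l e \<in> S}"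
      using in1 by (intro measure_pmf.finite_measure_mono) auto
    also have "\<dots> = q"
      using V by (subst prob_labels_Ball) (auto simp: doubleton_in_all_edges prob_S)
    finally have "measure_pmf.prob labels (leaf_event i \<inter> leaf_event j) \<le> q" .
    then show ?thesis using same nn q_bounds(1,2) by (smt (verit))
  next
    case empty
    have "leaf_event i \<inter> leaf_event j = {}"
    proof (rule ccontr)
      assume "leaf_event i \<inter> leaf_event j \<noteq> {}"
      then obtain l where l: "l \<in> leaf_event i" "l \<in> leaf_event j" by blast
      from empty(2) show False
      proof (elim disjE)
        assume "v = v'"
        then show False using out1[OF l(1), of w'] in2[OF l(2)] V empty(1) i j by auto
      next
        assume "w = v'"
        then show False using out2[OF l(2), of v] in1[OF l(1)] V empty(1) i j
          by (auto simp: insert_commute)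
      next
        assume "w' = v"
        then show False using out1[OF l(1), of v'] in2[OF l(2)] V empty(1) i j
          by (auto simp: insert_commute)
      qed
    qed
    then show ?thesis using nn q_bounds by simp
  next
    case indep
    let ?F = "star v \<union> star v'" and ?T = "{{v, w}, {v', w'}}"
    have F: "?F \<subseteq> all_edges V" using star_subset by auto
    have T: "?T \<subseteq> ?F" using V by (auto simp: star_def doubleton_in_all_edges)
    have cT: "card ?T = 2" using indep V by (auto simp: doubleton_eq_iff)
    \<comment> \<open>This keeps the natural subtractions in the exponents from truncating.\<close>
    have n3: "n \<ge> 3"
    proof -
      have "card {v, v', w} \<le> card V" using V by (intro card_mono) auto
      then show ?thesis using indep V by simp
    qed
    have "{v', w'} \<notin> star v" "{v, w} \<notin> star v'" using indep V by (auto simp: star_def)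
    then have "leaf_event i \<inter> leaf_event j = {l. \<forall>e\<in>?F. l e \<in> (if e \<in> ?T then S - S\<^sub>0 else - S)}"
      unfolding leaf_event_def i j by auto
    then have "measure_pmf.prob labels (leaf_event i \<inter> leaf_event j)
        = (q - q\<^sub>0)\<^sup>2 * (1 - q) ^ (2 * n - 3 - 2)"
      using prob_labels_two[OF F T, of "S - S\<^sub>0" "- S"] cT card_star_Un[of v v'] V indep
      by (simp add: prob_Diff prob_Compl)
    \<comment> \<open>The common edge is required to avoid \<open>S\<close> only once, so the
      exponent is one less than \<open>2 * (n - 2)\<close>; this is the origin of
      \<open>1 / (1 - q)\<close>.\<close>
    also have "(1 - q) ^ (2 * n - 3 - 2) = ((1 - q) ^ (n - 2))\<^sup>2 / (1 - q)"
    proof -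
      have "(n - 2) * 2 = Suc (2 * n - 3 - 2)" using n3 by simp
      then have "((1 - q) ^ (n - 2))\<^sup>2 = (1 - q) * (1 - q) ^ (2 * n - 3 - 2)"
        by (metis power_Suc power_mult)
      then show ?thesis using assms(3) by simp
    qed
    finally show ?thesis using q_bounds by (simp add: leaf_prob_def power_mult_distrib)
  qed
qed

definition leaf_count :: "(nat set \<Rightarrow> 'l) \<Rightarrow> nat" where
  "leaf_count l = card {i \<in> vertex_pairs. l \<in> leaf_event i}"

text \<open>Equal and swapped pairs contribute \<open>2 * N * q\<close>; the excess over
  independence is the factor \<open>1 / (1 - q) - 1 = q / (1 - q)\<close>.\<close>

lemma Chebyshev_leaf_count:
  assumes "t > 0" "q < 1"
  defines "N \<equiv> real n * (real n - 1)"
  shows "measure_pmf.prob labels {l. t \<le> \<bar>real (leaf_count l) - N * leaf_prob\<bar>}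
    \<le> (2 * N * q + (N * leaf_prob)\<^sup>2 * (q / (1 - q))) / t\<^sup>2"
proof -
  let ?I = vertex_pairs
  have cN: "real (card ?I) = N" by (simp add: N_def card_vertex_pairs)
  have "(\<Sum>i\<in>?I. measure_pmf.prob labels (leaf_event i)) = (\<Sum>i\<in>?I. leaf_prob)"
    using prob_leaf_event by (intro sum.cong refl) (metis prod.collapse)
  then have \<mu>: "(\<Sum>i\<in>?I. measure_pmf.prob labels (leaf_event i)) = N * leaf_prob"
    by (simp add: cN)
  have swap: "prod.swap i \<in> ?I" if "i \<in> ?I" for i using that by (auto simp: vertex_pairs_def)
  have "(\<Sum>i\<in>?I. \<Sum>j\<in>?I. measure_pmf.prob labels (leaf_event i \<inter> leaf_event j))
      \<le> (\<Sum>i\<in>?I. \<Sum>j\<in>?I. (if j = i then q else 0) + (if j = prod.swap i then q else 0) + leaf_prob\<^sup>2 / (1 - q))"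
    using assms(2) by (intro sum_mono prob_leaf_event_Int)
  also have "\<dots> = (\<Sum>i\<in>?I. q + q + N * (leaf_prob\<^sup>2 / (1 - q)))"
    by (intro sum.cong refl) (simp add: sum.distrib finite_vertex_pairs swap cN)
  also have "\<dots> = 2 * N * q + (N * leaf_prob)\<^sup>2 * (1 / (1 - q))"
    by (simp add: cN power2_eq_square algebra_simps)
  also have "1 / (1 - q) = q / (1 - q) + 1" using assms(2) by (simp add: field_simps)
  finally have "(\<Sum>i\<in>?I. \<Sum>j\<in>?I. measure_pmf.prob labels (leaf_event i \<inter> leaf_event j)) - (N * leaf_prob)\<^sup>2
      \<le> 2 * N * q + (N * leaf_prob)\<^sup>2 * (q / (1 - q))"
    by (simp add: distrib_left)
  then have "((\<Sum>i\<in>?I. \<Sum>j\<in>?I. measure_pmf.prob labels (leaf_event i \<inter> leaf_event j)) - (N * leaf_prob)\<^sup>2) / t\<^sup>2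
      \<le> (2 * N * q + (N * leaf_prob)\<^sup>2 * (q / (1 - q))) / t\<^sup>2"
    by (rule divide_right_mono) simp
  with Chebyshev_card[OF finite_vertex_pairs assms(1), of labels leaf_event, unfolded \<mu>]
  show ?thesis unfolding leaf_count_def by simp
qed

text \<open>The graph \<open>H\<^sub>0 \<union> P\<close> of the overview, whose components are the
  clusters.\<close>

definition core :: "(nat set \<Rightarrow> 'l) \<Rightarrow> nat set set" where
  "core l = lo l \<union> pendant_edges (hi l)"

lemma core_subset_hi: "core l \<subseteq> hi l"
  using lo_subset_hi by (auto simp: core_def pendant_edges_def)

text \<open>Each leaf event orients a pendant edge outside \<open>lo l\<close>. An edge has two
  orientations, and an isolated edge may realise both, hence the division by 2.\<close>

lemma card_core_ge: "real (card (core l)) \<ge> real (card (lo l)) + real (leaf_count l) / 2"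
proof -
  let ?P = "pendant_edges (hi l) - lo l"
  have P: "?P \<subseteq> all_edges V" using hi_subset by (auto simp: pendant_edges_def)
  have fin: "finite ?P" "finite (lo l)"
    using finite_edge_set[of V] P lo_subset_hi[of l] hi_subset[of l] by (auto intro: finite_subset)
  have "{i \<in> vertex_pairs. l \<in> leaf_event i} \<subseteq> {p \<in> V \<times> V. {fst p, snd p} \<in> ?P}"
  proof
    fix i assume i': "i \<in> {i \<in> vertex_pairs. l \<in> leaf_event i}"
    obtain v w where i: "i = (v, w)" by (cases i)
    have vw: "v \<in> V" "w \<in> V" "v \<noteq> w" and l: "l \<in> leaf_event (v, w)"
      using i' by (auto simp: vertex_pairs_def i)
    have st: "{v, w} \<in> star v" using vw by (auto simp: star_def doubleton_in_all_edges)
    have "l {v, w} \<in> S - S\<^sub>0" using l st unfolding leaf_event_def by auto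
    then have "{v, w} \<in> hi l" "{v, w} \<notin> lo l"
      using st star_subset[of v] by (auto simp: hi_def lo_def)
    moreover have "e = {v, w}" if "e \<in> hi l" "v \<in> e" for e
    proof (rule ccontr)
      assume ne: "e \<noteq> {v, w}"
      have "e \<in> star v" using that by (auto simp: star_def hi_def)
      then have "l e \<in> (if e \<in> {{v, w}} then S - S\<^sub>0 else - S)"
        using l unfolding leaf_event_def by blast
      then have "l e \<notin> S" using ne by simp
      then show False using that by (simp add: hi_def)
    qed
    ultimately have "{v, w} \<in> ?P" unfolding pendant_edges_def by blast
    then show "i \<in> {p \<in> V \<times> V. {fst p, snd p} \<in> ?P}" using vw i by simp
  qed
  then have "leaf_count l \<le> card {p \<in> V \<times> V. {fst p, snd p} \<in> ?P}"
    unfolding leaf_count_def by (intro card_mono) auto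
  also have "real (card {p \<in> V \<times> V. {fst p, snd p} \<in> ?P}) = 2 * real (card ?P)"
    using card_ordered_pairs[OF finite_V P] by simp
  finally have "real (leaf_count l) \<le> 2 * real (card ?P)" by simp
  moreover have "core l = lo l \<union> ?P" by (auto simp: core_def)
  then have "card (core l) = card (lo l) + card ?P"
    using fin by (metis Diff_disjoint card_Un_disjoint)
  ultimately show ?thesis by simp
qed

section \<open>Counting paths in the core: cluster sizes and short-circuited edges\<close>

definition inner_paths :: "nat \<Rightarrow> nat \<Rightarrow> nat list set" where
  "inner_paths u v = {ys. ys \<noteq> [] \<and> distinct (u # ys @ [v]) \<and> set ys \<subseteq> V}"

lemma inner_paths_subset: "inner_paths u v \<subseteq> (\<Union>j<n. {ys. set ys \<subseteq> V \<and> length ys = Suc j})"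
proof
  fix ys assume ys: "ys \<in> inner_paths u v"
  then have "card (set ys) = length ys" "card (set ys) \<le> card V"
    using distinct_card[of ys] card_mono[of V "set ys"] by (auto simp: inner_paths_def)
  then have "length ys \<le> n" by simp
  moreover obtain j where "length ys = Suc j"
    using ys by (cases ys) (auto simp: inner_paths_def)
  ultimately show "ys \<in> (\<Union>j<n. {ys. set ys \<subseteq> V \<and> length ys = Suc j})"
    using ys by (auto simp: inner_paths_def)
qed

lemma finite_inner_paths: "finite (inner_paths u v)"
  using inner_paths_subset by (rule finite_subset) (auto intro: finite_lists_length_eq)

text \<open>There are at most \<open>n ^ (j + 1)\<close> lists with \<open>j\<close> inner edges,
  each of weight \<open>q\<^sub>0 ^ j\<close>. Subcriticality \<open>n q\<^sub>0 < 1\<close> makes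
  the geometric series converge.\<close>

lemma sum_inner_paths_le:
  assumes "real n * q\<^sub>0 < 1"
  shows "(\<Sum>ys\<in>inner_paths u v. q\<^sub>0 ^ (length ys - 1)) \<le> real n / (1 - real n * q\<^sub>0)"
proof -
  let ?L = "\<lambda>j. {ys. set ys \<subseteq> V \<and> length ys = Suc j}"
  have fin: "finite (?L j)" for j by (rule finite_lists_length_eq) simp
  have "(\<Sum>ys\<in>inner_paths u v. q\<^sub>0 ^ (length ys - 1)) \<le> (\<Sum>ys\<in>(\<Union>j<n. ?L j). q\<^sub>0 ^ (length ys - 1))"
    using inner_paths_subset fin q_bounds by (intro sum_mono2) auto
  also have "\<dots> = (\<Sum>j<n. \<Sum>ys\<in>?L j. q\<^sub>0 ^ (length ys - 1))"
    using fin by (intro sum.UNION_disjoint) auto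
  also have "\<dots> = (\<Sum>j<n. \<Sum>ys\<in>?L j. q\<^sub>0 ^ j)" by (intro sum.cong refl) auto
  also have "\<dots> = (\<Sum>j<n. real n * (real n * q\<^sub>0) ^ j)"
    using card_lists_length_eq[of V] by (simp add: power_mult_distrib mult.assoc)
  also have "\<dots> = real n * (\<Sum>j<n. (real n * q\<^sub>0) ^ j)" by (simp add: sum_distrib_left)
  also have "(\<Sum>j<n. (real n * q\<^sub>0) ^ j) = (1 - (real n * q\<^sub>0) ^ n) / (1 - real n * q\<^sub>0)"
    using assms by (simp add: sum_gp_strict)
  also have "\<dots> \<le> 1 / (1 - real n * q\<^sub>0)"
    using assms q_bounds by (intro divide_right_mono) auto
  finally show ?thesis by (simp add: mult_left_mono)
qed

text \<open>Only the two end edges of a path may be pendant, so they are required in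
  \<open>hi l\<close> and all inner edges in \<open>lo l\<close>. The set \<open>T\<close> holds an
  extra edge when a cycle is to be closed.\<close>

definition path_event :: "nat set set \<Rightarrow> nat \<Rightarrow> nat \<Rightarrow> (nat set \<Rightarrow> 'l) set" where
  "path_event T u v = (\<Union>ys\<in>inner_paths u v.
     {l. insert {u, hd ys} (insert {last ys, v} T) \<subseteq> hi l \<and> path_edges ys \<subseteq> lo l})"

lemma prob_path_event:
  assumes "T \<subseteq> {{u, v}}" "u \<in> V" "v \<in> V" "u \<noteq> v" "real n * q\<^sub>0 < 1"
  shows "measure_pmf.prob labels (path_event T u v) \<le> q ^ (2 + card T) * (real n / (1 - real n * q\<^sub>0))"
proof -
  have T: "finite T" "T \<subseteq> all_edges V"
    using assms finite_subset[OF assms(1)] by (auto simp: doubleton_in_all_edges)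
  have "measure_pmf.prob labels (path_event T u v)
    \<le> (\<Sum>ys\<in>inner_paths u v. measure_pmf.prob labels
        {l. insert {u, hd ys} (insert {last ys, v} T) \<subseteq> hi l \<and> path_edges ys \<subseteq> lo l})"
    unfolding path_event_def by (intro measure_pmf.finite_measure_subadditive_finite finite_inner_paths) auto
  also have "\<dots> = (\<Sum>ys\<in>inner_paths u v. q ^ (2 + card T) * q\<^sub>0 ^ (length ys - 1))"
  proof (intro sum.cong refl)
    fix ys assume "ys \<in> inner_paths u v"
    then have ys: "ys \<noteq> []" "distinct (u # ys @ [v])" "set ys \<subseteq> V" by (auto simp: inner_paths_def)
    have hl: "hd ys \<in> set ys" "last ys \<in> set ys" using ys(1) by auto
    then have hl': "hd ys \<in> V" "last ys \<in> V" "hd ys \<noteq> u" "hd ys \<noteq> v" "last ys \<noteq> u" "last ys \<noteq> v"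
      using ys by auto
    let ?F = "insert {u, hd ys} (insert {last ys, v} T)"
    have "{u, hd ys} \<notin> insert {last ys, v} T" "{last ys, v} \<notin> T"
      using assms(1,4) hl' by (auto simp: doubleton_eq_iff)
    then have cF: "card ?F = 2 + card T" using T by simp
    have F: "?F \<subseteq> all_edges V" using T hl' assms by (auto simp: doubleton_in_all_edges)
    \<comment> \<open>End edges and \<open>T\<close> meet \<open>u\<close> or \<open>v\<close>,
      inner edges do not; disjointness lets the probabilities multiply.\<close>
    have "?F \<inter> path_edges ys = {}"
    proof -
      have "u \<in> e \<or> v \<in> e" if "e \<in> ?F" for e using that assms(1) by auto
      moreover have "u \<notin> e \<and> v \<notin> e" if "e \<in> path_edges ys" for e
        using path_edges_subset[OF that] ys(2) by auto
      ultimately show ?thesis by blast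
    qed
    moreover have "path_edges ys \<subseteq> all_edges V" using ys by (intro path_edges_all_edges) auto
    ultimately show "measure_pmf.prob labels {l. ?F \<subseteq> hi l \<and> path_edges ys \<subseteq> lo l}
        = q ^ (2 + card T) * q\<^sub>0 ^ (length ys - 1)"
      using prob_hi_lo[OF F] cF card_path_edges[of ys] ys(2) by simp
  qed
  also have "\<dots> \<le> q ^ (2 + card T) * (real n / (1 - real n * q\<^sub>0))"
    unfolding sum_distrib_left[symmetric] using q_bounds sum_inner_paths_le[OF assms(5)]
    by (intro mult_left_mono) auto
  finally show ?thesis .
qed

lemma path_eventI:
  assumes "(u, v) \<in> (adj (core l - D'))\<^sup>*" "u \<in> V" "v \<in> V" "u \<noteq> v" "T \<subseteq> hi l"
    "{u, v} \<in> D' \<or> {u, v} \<notin> core l"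
  shows "l \<in> path_event T u v"
proof -
  obtain ys where ys: "ys \<noteq> []" "distinct (u # ys @ [v])" "{u, hd ys} \<in> hi l" "{last ys, v} \<in> hi l"
    "path_edges ys \<subseteq> lo l"
    using connected_interior_path[OF assms(1,4) core_def lo_subset_hi assms(6)] by blast
  \<comment> \<open>A vertex of a list is its head or lies on one of its edges. This places the
    whole path in \<open>V\<close>.\<close>
  have cov: "x = hd zs \<or> (\<exists>e\<in>path_edges zs. x \<in> e)" if "x \<in> set zs" for x :: nat and zs
    using that by (induction zs rule: path_edges.induct) auto
  have "x \<in> V" if "x \<in> set ys" for x
    using cov[OF that] ys(3,5) lo_subset_hi hi_subset
    by (elim disjE) (auto simp: hi_def lo_def all_edges_def)
  then have "ys \<in> inner_paths u v" using ys by (auto simp: inner_paths_def)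
  then show ?thesis using ys assms(5) unfolding path_event_def by blast
qed

text \<open>Diagonal pairs account for \<open>n\<close>; any other linked pair is joined by an edge
  or by a path with two end edges. For \<open>q = O(1 / n)\<close> the expectation is
  \<open>O(n)\<close>.\<close>

lemma Markov_linked_pairs:
  assumes "real n * q\<^sub>0 < 1" "t > 0"
  shows "measure_pmf.prob labels {l. t \<le> real (card (linked_pairs V (core l)))}
    \<le> (real n + (real n)\<^sup>2 * (q + q\<^sup>2 * (real n / (1 - real n * q\<^sub>0)))) / t"
proof -
  let ?A = "\<lambda>p. {l. (fst p, snd p) \<in> (adj (core l))\<^sup>*}"
  let ?c = "q + q\<^sup>2 * (real n / (1 - real n * q\<^sub>0))"
  have c0: "?c \<ge> 0" using q_bounds assms(1) by (intro add_nonneg_nonneg mult_nonneg_nonneg divide_nonneg_pos) auto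
  have pr: "measure_pmf.prob labels (?A p) \<le> (if snd p = fst p then 1 else 0) + ?c" if p: "p \<in> V \<times> V" for p
  proof (cases "snd p = fst p")
    case False
    obtain u v where uv: "p = (u, v)" by (cases p)
    have V: "u \<in> V" "v \<in> V" "u \<noteq> v" using p False uv by auto
    have "?A p \<subseteq> {l. {{u, v}} \<subseteq> hi l \<and> {} \<subseteq> lo l} \<union> path_event {} u v"
    proof
      fix l assume l: "l \<in> ?A p"
      show "l \<in> {l. {{u, v}} \<subseteq> hi l \<and> {} \<subseteq> lo l} \<union> path_event {} u v"
      proof (cases "{u, v} \<in> core l")
        case True
        then show ?thesis using core_subset_hi by auto
      next
        case False
        then show ?thesis using path_eventI[of u v l "{}" "{}"] l V uv by simp
      qed
    qed
    then have "measure_pmf.prob labels (?A p)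
        \<le> measure_pmf.prob labels ({l. {{u, v}} \<subseteq> hi l \<and> {} \<subseteq> lo l} \<union> path_event {} u v)"
      by (intro measure_pmf.finite_measure_mono) auto
    also have "\<dots> \<le> measure_pmf.prob labels {l. {{u, v}} \<subseteq> hi l \<and> {} \<subseteq> lo l}
        + measure_pmf.prob labels (path_event {} u v)"
      by (rule measure_Un_le) auto
    also have "measure_pmf.prob labels {l. {{u, v}} \<subseteq> hi l \<and> {} \<subseteq> lo l} = q"
      using prob_hi_lo[of "{{u, v}}" "{}"] V by (simp add: doubleton_in_all_edges)
    also have "measure_pmf.prob labels (path_event {} u v) \<le> q\<^sup>2 * (real n / (1 - real n * q\<^sub>0))"
      using prob_path_event[of "{}" u v] V assms(1) by simp
    finally show ?thesis using False by simp
  next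
    case True
    have "measure_pmf.prob labels (?A p) \<le> 1" by simp
    then show ?thesis using True c0 by simp
  qed
  have eq: "linked_pairs V (core l) = {p \<in> V \<times> V. l \<in> ?A p}" for l by (auto simp: linked_pairs_def)
  have "(\<Sum>p\<in>V \<times> V. measure_pmf.prob labels (?A p))
      \<le> (\<Sum>p\<in>V \<times> V. (if snd p = fst p then 1 else 0) + ?c)"
    by (rule sum_mono[OF pr])
  also have "\<dots> = (\<Sum>u\<in>V. \<Sum>v\<in>V. (if v = u then 1 else 0) + ?c)"
    by (simp add: sum.cartesian_product case_prod_beta)
  also have "\<dots> = real n + (real n)\<^sup>2 * ?c"
    by (simp add: sum.distrib power2_eq_square algebra_simps)
  finally have "(\<Sum>p\<in>V \<times> V. measure_pmf.prob labels (?A p)) / t \<le> (real n + (real n)\<^sup>2 * ?c) / t"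
    using assms(2) by (intro divide_right_mono) auto
  then show ?thesis
    unfolding eq using Markov_card[of "V \<times> V" t labels ?A] assms(2) by simp
qed

text \<open>A bad edge closes a cycle, so its own probability is a third factor \<open>q\<close>,
  and the expected number is \<open>O(1)\<close> when \<open>q = O(1 / n)\<close>.\<close>

lemma Markov_bad_edges:
  assumes "real n * q\<^sub>0 < 1" "t > 0"
  shows "measure_pmf.prob labels {l. t \<le> real (card (bad_edges (core l) (hi l)))}
    \<le> (real n)\<^sup>2 * (q ^ 3 * (real n / (1 - real n * q\<^sub>0))) / t"
proof -
  let ?A = "\<lambda>p. path_event {{fst p, snd p}} (fst p) (snd p)"
  let ?I = vertex_pairs
  let ?c = "q ^ 3 * (real n / (1 - real n * q\<^sub>0))"
  have c0: "?c \<ge> 0" using q_bounds assms(1) by (intro mult_nonneg_nonneg divide_nonneg_pos) auto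
  have sub: "bad_edges (core l) (hi l) \<subseteq> (\<lambda>p. {fst p, snd p}) ` {p \<in> ?I. l \<in> ?A p}" for l
  proof
    fix e assume "e \<in> bad_edges (core l) (hi l)"
    then obtain u v where e: "e = {u, v}" "e \<in> hi l" "(u, v) \<in> (adj (core l - {e}))\<^sup>*"
      by (auto simp: bad_edges_def)
    have V: "u \<in> V" "v \<in> V" "u \<noteq> v"
      using e(1,2) hi_subset doubleton_in_all_edges[of u v V] by auto
    have "l \<in> path_event {{u, v}} u v"
      using path_eventI[OF e(3) V, of "{{u, v}}"] e by simp
    then show "e \<in> (\<lambda>p. {fst p, snd p}) ` {p \<in> ?I. l \<in> ?A p}"
      using V e(1) by (intro image_eqI[of _ _ "(u, v)"]) (auto simp: vertex_pairs_def)
  qed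
  have le: "card (bad_edges (core l) (hi l)) \<le> card {p \<in> ?I. l \<in> ?A p}" for l
    using finite_vertex_pairs by (intro surj_card_le[OF _ sub]) auto
  have "measure_pmf.prob labels {l. t \<le> real (card (bad_edges (core l) (hi l)))}
      \<le> measure_pmf.prob labels {l. t \<le> real (card {p \<in> ?I. l \<in> ?A p})}"
  proof (intro measure_pmf.finite_measure_mono subsetI CollectI)
    fix l assume "l \<in> {l. t \<le> real (card (bad_edges (core l) (hi l)))}"
    then show "t \<le> real (card {p \<in> ?I. l \<in> ?A p})" using le[of l] by simp
  qed auto
  also have "\<dots> \<le> (\<Sum>p\<in>?I. measure_pmf.prob labels (?A p)) / t"
    by (rule Markov_card[OF finite_vertex_pairs assms(2)])
  also have "\<dots> \<le> (\<Sum>p\<in>?I. ?c) / t"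
  proof (intro divide_right_mono sum_mono)
    fix p assume "p \<in> ?I"
    then show "measure_pmf.prob labels (?A p) \<le> ?c"
      using prob_path_event[of "{{fst p, snd p}}" "fst p" "snd p"] assms(1)
      by (auto simp: vertex_pairs_def numeral_3_eq_3)
  qed (use assms(2) in auto)
  also have "\<dots> = real n * (real n - 1) * ?c / t" by (simp add: card_vertex_pairs)
  also have "\<dots> \<le> (real n)\<^sup>2 * ?c / t"
    using assms(2) c0 by (intro divide_right_mono mult_right_mono) (auto simp: power2_eq_square mult_left_mono)
  finally show ?thesis .
qed

end

subsection \<open>Concentration and limits\<close>

context edge_labelling
begin

lemma prob_binomial_random_graph:
  "measure_pmf.prob (binomial_random_graph n (1 - q)) {E. Q E}
    = measure_pmf.prob labels {l. Q (all_edges V - hi l)}"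
  unfolding binomial_random_graph_eq by (simp add: vimage_def)

lemma prob_compl_ge:
  assumes "measure_pmf.prob labels B \<le> b" "- B \<subseteq> A"
  shows "1 - b \<le> measure_pmf.prob labels A"
proof -
  have "1 - measure_pmf.prob labels B = measure_pmf.prob labels (- B)"
    using measure_pmf.prob_compl[of B labels] by (simp add: Compl_eq_Diff_UNIV)
  also have "\<dots> \<le> measure_pmf.prob labels A"
    using assms(2) by (intro measure_pmf.finite_measure_mono) auto
  finally show ?thesis using assms(1) by linarith
qed

text \<open>The expected number of edges of the complement lies below the threshold
  \<open>(n - 1) / 2\<close> by about \<open>w * sqrt n / 2\<close>, while its standard deviation is
  of order at most \<open>sqrt n\<close>.\<close>

lemma prob_modularity_eq_0:
  assumes "n \<ge> 2" "w > 0" "q \<le> 1 / real n - w / real n powr (3 / 2)"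
  shows "1 - 8 / w\<^sup>2 \<le> measure_pmf.prob (binomial_random_graph n (1 - q)) {E. modularity {1..n} E = 0}"
proof -
  define x where "x = real n"
  have x: "x \<ge> 2" using assms(1) by (simp add: x_def)
  let ?N = "real n * (real n - 1) / 2"
  \<comment> \<open>The gap between the threshold \<open>(x - 1) / 2\<close> and the upper bound for
    the mean.\<close>
  define t where "t = (x - 1) * w / (2 * sqrt x)"
  have t: "t > 0" using x assms(2) by (simp add: t_def)
  have pw: "x powr (3 / 2) = x * sqrt x"
  proof -
    have "x powr (3 / 2) = x powr (1 + 1 / 2)" by simp
    also have "\<dots> = x * sqrt x" using x by (subst powr_add) (simp add: powr_half_sqrt)
    finally show ?thesis .
  qed
  have "?N * q \<le> ?N * (1 / x - w / (x * sqrt x))"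
    using assms(3) x by (intro mult_left_mono) (auto simp: x_def[symmetric] pw)
  also have "\<dots> = x / 2 - 1 / 2 - t"
    using x by (simp add: x_def[symmetric] t_def field_simps)
  finally have Nq: "?N * q \<le> x / 2 - 1 / 2 - t" .
  have Nq': "?N * q \<le> x / 2" by (rule order_trans[OF Nq]) (use t in \<open>simp add: field_simps\<close>)
  have "?N * q / t\<^sup>2 \<le> (x / 2) / (x * w\<^sup>2 / 16)"
  proof (rule frac_le)
    \<comment> \<open>This uses \<open>x - 1 \<ge> x / 2\<close>.\<close>
    have "(x / 2) * w / (2 * sqrt x) \<le> t"
      unfolding t_def using x assms(2) by (intro divide_right_mono mult_right_mono) auto
    then have "((x / 2) * w / (2 * sqrt x))\<^sup>2 \<le> t\<^sup>2" using x assms(2) by (intro power_mono) auto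
    then show "x * w\<^sup>2 / 16 \<le> t\<^sup>2"
      using x by (simp add: power_divide power_mult_distrib) (simp add: power2_eq_square)
  qed (use Nq' t x assms(2) in simp_all)
  also have "\<dots> = 8 / w\<^sup>2" using x by simp
  finally have "measure_pmf.prob labels {l. t \<le> \<bar>real (card (hi l)) - ?N * q\<bar>} \<le> 8 / w\<^sup>2"
    using Chebyshev_label_count[OF t, of S] unfolding prob_S hi_def[symmetric] by linarith
  moreover have "- {l. t \<le> \<bar>real (card (hi l)) - ?N * q\<bar>} \<subseteq> {l. modularity V (all_edges V - hi l) = 0}"
  proof
    fix l assume "l \<in> - {l. t \<le> \<bar>real (card (hi l)) - ?N * q\<bar>}"
    then have "\<not> t \<le> \<bar>real (card (hi l)) - ?N * q\<bar>" by simp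
    moreover have "2 * h \<le> x - 1" if "\<not> t \<le> \<bar>h - y\<bar>" "y \<le> x / 2 - 1 / 2 - t" for h y
      using that by linarith
    ultimately have "2 * real (card (hi l)) \<le> real (card V) - 1"
      using Nq unfolding card_V x_def[symmetric] by blast
    moreover have "V \<noteq> {}" using assms(1) by (auto simp: V_def)
    ultimately show "l \<in> {l. modularity V (all_edges V - hi l) = 0}"
      using modularity_eq_0[OF finite_V _ hi_subset] by simp
  qed
  ultimately show ?thesis
    unfolding prob_binomial_random_graph V_def[symmetric] by (rule prob_compl_ge)
qed

text \<open>The deterministic half of (b). The thinned copy corresponds to
  \<open>\<eta> = \<kappa> / 8\<close>, and all other tolerances are fractions of
  \<open>\<kappa>\<close> such that the gain from leaf edges outweighs every loss.\<close>

lemma modularity_bounds: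
  fixes \<kappa> \<kappa>\<^sub>1 c :: real
  assumes "c > 0" "\<kappa> > 0" and \<kappa>\<^sub>1: "(2 + 128 * c / \<kappa>) * (c / 4) * \<kappa>\<^sub>1 = \<kappa> / 128"
    and n: "real n \<ge> 2 + 4 * c" "real n \<ge> 128 * c\<^sup>2 / \<kappa>"
    and M: "real (card (hi l)) \<le> c * real n"
    and lo: "real n / 2 * (1 - \<kappa> / 8) - \<kappa> * real n / 16 \<le> real (card (lo l))"
    and leaf: "\<kappa> * real n / 2 \<le> real (leaf_count l)"
    and bad: "real (card (bad_edges (core l) (hi l))) \<le> \<kappa> * real n / 32"
    and linked: "real (card (linked_pairs V (core l))) \<le> \<kappa>\<^sub>1 * (real n)\<^sup>2"
  shows "\<kappa> / 64 / real n \<le> modularity V (all_edges V - hi l)"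
    and "modularity V (all_edges V - hi l) \<le> 8 * c / real n"
proof -
  define x M where "x = real n" and "M = real (card (hi l))"
  let ?E = "all_edges V - hi l"
  have x: "x \<ge> 2 + 4 * c" "x > 0" using n assms(1) by (simp_all add: x_def)
  have Mx: "M \<le> c * x" "M \<ge> 0" using M by (simp_all add: M_def x_def)
  have m: "real (card ?E) = x * (x - 1) / 2 - M"
    using card_complement[OF finite_V hi_subset] by (simp add: x_def M_def)
  \<comment> \<open>The bound \<open>x \<ge> 2 + 4 * c\<close> is what makes
    \<open>x * (x - 1) / 2 - c * x\<close> at least \<open>x\<^sup>2 / 4\<close>.\<close>
  have "x * (2 + 4 * c) \<le> x * x" using x by (intro mult_left_mono) auto
  then have m4: "x\<^sup>2 / 4 \<le> real (card ?E)"
    unfolding m using Mx by (simp add: power2_eq_square field_simps)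
  have m2: "real (card ?E) \<le> x\<^sup>2 / 2"
    unfolding m using Mx x by (simp add: power2_eq_square field_simps)
  have m0: "real (card ?E) > 0" using m4 x by (smt (verit) divide_pos_pos zero_less_power)
  then have E: "?E \<noteq> {}" by (metis card.empty less_irrefl of_nat_0)
  have "modularity V ?E \<le> x\<^sup>2 * M / (2 * real (card ?E) ^ 2)"
    using modularity_complement_le[OF finite_V hi_subset E] by (simp add: x_def M_def)
  also have "\<dots> \<le> x\<^sup>2 * (c * x) / (2 * (x\<^sup>2 / 4) ^ 2)"
    using Mx x m4 by (intro frac_le mult_left_mono power_mono) (auto intro: mult_nonneg_nonneg)
  also have "\<dots> = 8 * c / x" using x by (simp add: power2_eq_square field_simps)
  finally show "modularity V (all_edges V - hi l) \<le> 8 * c / real n" by (simp add: x_def)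
  define \<tau> where "\<tau> = \<kappa> / (128 * c)"
  have \<tau>: "\<tau> > 0" "1 / \<tau> = 128 * c / \<kappa>" "\<tau> * c = \<kappa> / 128" using assms(1,2) by (simp_all add: \<tau>_def)
  have Vne: "V \<noteq> {}" using x by (auto simp: V_def x_def)
  obtain A where A: "A \<subseteq> V" "part_gain V ?E A
     \<ge> x\<^sup>2 * ((real (card (core l)) - 2 * real (card (bad_edges (core l) (hi l)))) / 2 - x / 4)
        - (2 + 1 / \<tau>) * (M / 4) * real (card (linked_pairs V (core l))) - \<tau> * x\<^sup>2 * M - M\<^sup>2"
    using exists_part_gain_ge[OF finite_V hi_subset core_subset_hi \<tau>(1) Vne]
    by (auto simp: x_def M_def)
  \<comment> \<open>Leaf edges add \<open>\<kappa> * x / 4\<close>; thinning, deviation of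
    \<open>lo l\<close> and twice the bad edges cost \<open>\<kappa> * x / 16\<close> each.\<close>
  have "x / 2 + \<kappa> * x / 16 \<le> real (card (core l)) - 2 * real (card (bad_edges (core l) (hi l)))"
    using card_core_ge[of l] lo leaf bad unfolding x_def[symmetric] by (simp add: field_simps)
  then have "\<kappa> * x / 32 \<le> (real (card (core l)) - 2 * real (card (bad_edges (core l) (hi l)))) / 2 - x / 4"
    by (simp add: field_simps)
  then have 1: "x\<^sup>2 * (\<kappa> * x / 32)
      \<le> x\<^sup>2 * ((real (card (core l)) - 2 * real (card (bad_edges (core l) (hi l)))) / 2 - x / 4)"
    by (rule mult_left_mono) simp
  \<comment> \<open>Each of the following three errors takes at most a quarter of the main term
    \<open>x\<^sup>2 * (\<kappa> * x / 32)\<close>, by the choices of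
    \<open>\<kappa>\<^sub>1\<close> and \<open>\<tau>\<close> and the second lower bound on
    \<open>n\<close>; a quarter remains.\<close>
  have 2: "(2 + 1 / \<tau>) * (M / 4) * real (card (linked_pairs V (core l))) \<le> x\<^sup>2 * (\<kappa> * x / 128)"
  proof -
    have "(2 + 1 / \<tau>) * (M / 4) * real (card (linked_pairs V (core l)))
        \<le> (2 + 1 / \<tau>) * (c * x / 4) * (\<kappa>\<^sub>1 * x\<^sup>2)"
      using Mx \<tau>(1) linked assms(1) x unfolding x_def[symmetric]
      by (intro mult_mono mult_left_mono divide_right_mono) auto
    also have "\<dots> = (2 + 128 * c / \<kappa>) * (c / 4) * \<kappa>\<^sub>1 * (x\<^sup>2 * x)"
      unfolding \<tau>(2) by (simp add: algebra_simps)
    finally show ?thesis unfolding \<kappa>\<^sub>1 by (simp add: algebra_simps)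
  qed
  have 3: "\<tau> * x\<^sup>2 * M \<le> x\<^sup>2 * (\<kappa> * x / 128)"
  proof -
    have "\<tau> * x\<^sup>2 * M \<le> \<tau> * x\<^sup>2 * (c * x)" using Mx \<tau>(1) by (intro mult_left_mono) auto
    also have "\<dots> = \<tau> * c * (x\<^sup>2 * x)" by (simp add: algebra_simps)
    finally show ?thesis unfolding \<tau>(3) by (simp add: algebra_simps)
  qed
  have 4: "M\<^sup>2 \<le> x\<^sup>2 * (\<kappa> * x / 128)"
  proof -
    have "M\<^sup>2 \<le> (c * x)\<^sup>2" using Mx by (intro power_mono) auto
    also have "\<dots> = x\<^sup>2 * c\<^sup>2" by (simp add: power_mult_distrib)
    also have "\<dots> \<le> x\<^sup>2 * (\<kappa> * x / 128)"
      using n(2) assms(2) by (intro mult_left_mono) (auto simp: x_def field_simps)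
    finally show ?thesis .
  qed
  have D: "x\<^sup>2 * (\<kappa> * x / 128) \<le> part_gain V ?E A"
    using A(2) 1 2 3 4 by linarith
  have D0: "0 < x\<^sup>2 * (\<kappa> * x / 128)" using x assms(2) by simp
  have "\<kappa> / 64 / x = x\<^sup>2 * (\<kappa> * x / 128) / (2 * (x\<^sup>2 / 2)\<^sup>2)"
    using x by (simp add: power2_eq_square field_simps)
  also have "\<dots> \<le> part_gain V ?E A / (2 * real (card ?E) ^ 2)"
    using D D0 m0 m2 by (intro frac_le mult_left_mono power_mono) auto
  also have "\<dots> \<le> modularity V ?E"
    using D D0 by (intro modularity_ge_part_gain[OF finite_V Diff_subset E A(1)]) linarith
  finally show "\<kappa> / 64 / real n \<le> modularity V (all_edges V - hi l)" by (simp add: x_def)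
qed

text \<open>A union bound over five failure events, each of probability \<open>O(1 / n)\<close> with
  constants depending only on \<open>c\<close>, \<open>\<kappa>\<close> and
  \<open>\<kappa>\<^sub>1\<close>.\<close>

lemma prob_modularity_bounds:
  fixes \<kappa> \<kappa>\<^sub>1 c :: real
  assumes c: "c > 1" and \<kappa>: "\<kappa> > 0" "\<kappa> < 1"
    and \<kappa>\<^sub>1: "(2 + 128 * c / \<kappa>) * (c / 4) * \<kappa>\<^sub>1 = \<kappa> / 128"
    and n: "real n \<ge> 2 + 4 * c" "real n \<ge> 128 * c\<^sup>2 / \<kappa>"
    and q: "q \<le> c / real n" and q\<^sub>0: "real n * q\<^sub>0 = 1 - \<kappa> / 8"
    and leaf: "\<kappa> \<le> (real n - 1) * leaf_prob"
  shows "1 - (2 / c + 512 / \<kappa>\<^sup>2 + (8 * c + 8 * c ^ 3) / \<kappa>\<^sup>2 + 256 * c ^ 3 / \<kappa>\<^sup>2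
      + (1 + c + 8 * c\<^sup>2 / \<kappa>) / \<kappa>\<^sub>1) / real n
    \<le> measure_pmf.prob (binomial_random_graph n (1 - q))
        {E. \<kappa> / 64 / real n \<le> modularity {1..n} E \<and> modularity {1..n} E \<le> 8 * c / real n}"
proof -
  define x where "x = real n"
  let ?N = "real n * (real n - 1) / 2"
  have x: "x \<ge> 2 + 4 * c" "x > 0" "x \<ge> 1" using n c by (simp_all add: x_def)
  have \<kappa>\<^sub>1_pos: "\<kappa>\<^sub>1 > 0"
  proof -
    have "(2 + 128 * c / \<kappa>) * (c / 4) > 0" using c \<kappa> by (intro mult_pos_pos add_pos_pos) auto
    moreover have "(2 + 128 * c / \<kappa>) * (c / 4) * \<kappa>\<^sub>1 > 0" unfolding \<kappa>\<^sub>1 using \<kappa> by simp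
    ultimately show ?thesis by (rule zero_less_mult_pos[rotated])
  qed
  have q0: "0 \<le> q" and xq: "x * q \<le> c" using q_bounds q x by (auto simp: x_def field_simps)
  have qh: "q \<le> 1 / 2"
  proof -
    have "q \<le> c / x" using q by (simp add: x_def)
    also have "\<dots> \<le> 1 / 2" using x c by (simp add: field_simps)
    finally show ?thesis .
  qed
  have nq: "1 - real n * q\<^sub>0 = \<kappa> / 8" "real n * q\<^sub>0 < 1" using q\<^sub>0 \<kappa> by auto
  define B where "B = [
    {l. c * x / 2 \<le> \<bar>real (card (hi l)) - ?N * q\<bar>},
    {l. \<kappa> * x / 32 \<le> \<bar>real (card (lo l)) - ?N * q\<^sub>0\<bar>},
    {l. \<kappa> * x / 2 \<le> \<bar>real (leaf_count l) - real n * (real n - 1) * leaf_prob\<bar>},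
    {l. \<kappa> * x / 32 \<le> real (card (bad_edges (core l) (hi l)))},
    {l. \<kappa>\<^sub>1 * x\<^sup>2 \<le> real (card (linked_pairs V (core l)))}]"
  have p1: "measure_pmf.prob labels (B ! 0) \<le> 2 / c / x"
  proof -
    have "?N * q \<le> c * x / 2"
    proof -
      have "?N * q = (x - 1) * (x * q) / 2" by (simp add: x_def)
      also have "\<dots> \<le> x * c / 2"
        using xq x q0 by (intro divide_right_mono mult_mono) auto
      finally show ?thesis by (simp add: mult.commute)
    qed
    then have "?N * q / (c * x / 2)\<^sup>2 \<le> (c * x / 2) / (c * x / 2)\<^sup>2" by (rule divide_right_mono) simp
    also have "\<dots> = 2 / c / x" using c x by (simp add: power2_eq_square field_simps)
    finally show ?thesis
      using Chebyshev_label_count[of "c * x / 2" S] c x unfolding prob_S hi_def[symmetric]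
      by (simp add: B_def)
  qed
  have p2: "measure_pmf.prob labels (B ! 1) \<le> 512 / \<kappa>\<^sup>2 / x"
  proof -
    have "?N * q\<^sub>0 = (x - 1) * (real n * q\<^sub>0) / 2" by (simp add: x_def)
    also have "\<dots> \<le> x * 1 / 2"
      unfolding q\<^sub>0 using x \<kappa> by (intro divide_right_mono mult_mono) auto
    finally have "?N * q\<^sub>0 / (\<kappa> * x / 32)\<^sup>2 \<le> (x * 1 / 2) / (\<kappa> * x / 32)\<^sup>2" by (rule divide_right_mono) simp
    also have "\<dots> = 512 / \<kappa>\<^sup>2 / x" using \<kappa> x by (simp add: power2_eq_square field_simps)
    finally show ?thesis
      using Chebyshev_label_count[of "\<kappa> * x / 32" S\<^sub>0] \<kappa> x unfolding prob_S\<^sub>0 lo_def[symmetric]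
      by (simp add: B_def)
  qed
  have p3: "measure_pmf.prob labels (B ! 2) \<le> (8 * c + 8 * c ^ 3) / \<kappa>\<^sup>2 / x"
  proof -
    let ?L = "real n * (real n - 1) * leaf_prob"
    have l1: "0 \<le> leaf_prob" "leaf_prob \<le> q"
    proof -
      have "(q - q\<^sub>0) * (1 - q) ^ (n - 2) \<le> q * 1"
        using q_bounds by (intro mult_mono power_le_one) auto
      then show "leaf_prob \<le> q" by (simp add: leaf_prob_def)
    qed (use q_bounds in \<open>auto simp: leaf_prob_def\<close>)
    have N: "0 \<le> x * (x - 1)" "x * (x - 1) \<le> x * x" using x by (auto intro: mult_left_mono)
    have "?L \<le> x * x * q" unfolding x_def[symmetric] using N l1 x by (intro mult_mono) auto
    also have "\<dots> \<le> x * c" using xq x by (simp add: mult.assoc)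
    finally have "?L\<^sup>2 \<le> (x * c)\<^sup>2" using N l1 unfolding x_def[symmetric] by (intro power_mono) auto
    \<comment> \<open>As \<open>q \<le> 1 / 2\<close>, the correlation factor is at most
      \<open>2 * q\<close>.\<close>
    moreover have "q / (1 - q) \<le> q / (1 / 2)" using qh q0 by (intro divide_left_mono) auto
    then have "q / (1 - q) \<le> 2 * (c / x)" by (rule order_trans) (use q in \<open>simp add: x_def\<close>)
    ultimately have a: "?L\<^sup>2 * (q / (1 - q)) \<le> (x * c)\<^sup>2 * (2 * (c / x))"
      using q0 qh by (intro mult_mono) auto
    have "x * (x - 1) * q \<le> x * x * q" using N q0 by (intro mult_right_mono) auto
    also have "\<dots> \<le> x * c" using xq x by (simp add: mult.assoc)
    finally have b: "2 * (real n * (real n - 1)) * q \<le> 2 * (x * c)" by (simp add: x_def)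
    have "(2 * (real n * (real n - 1)) * q + ?L\<^sup>2 * (q / (1 - q))) / (\<kappa> * x / 2)\<^sup>2
        \<le> (2 * (x * c) + (x * c)\<^sup>2 * (2 * (c / x))) / (\<kappa> * x / 2)\<^sup>2"
      by (rule divide_right_mono[OF add_mono[OF b a]]) simp
    also have "\<dots> = (8 * c + 8 * c ^ 3) / \<kappa>\<^sup>2 / x"
      using x \<kappa> by (simp add: power2_eq_square power3_eq_cube field_simps)
    finally show ?thesis
      using Chebyshev_leaf_count[of "\<kappa> * x / 2"] \<kappa> x qh by (simp add: B_def)
  qed
  have p4: "measure_pmf.prob labels (B ! 3) \<le> 256 * c ^ 3 / \<kappa>\<^sup>2 / x"
  proof -
    have "(real n)\<^sup>2 * (q ^ 3 * (real n / (1 - real n * q\<^sub>0))) = (x * q) ^ 3 * (8 / \<kappa>)"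
      unfolding nq x_def by (simp add: power2_eq_square power3_eq_cube)
    also have "\<dots> \<le> c ^ 3 * (8 / \<kappa>)"
      using xq x q0 \<kappa> by (intro mult_right_mono power_mono) auto
    finally have "(real n)\<^sup>2 * (q ^ 3 * (real n / (1 - real n * q\<^sub>0))) / (\<kappa> * x / 32)
        \<le> c ^ 3 * (8 / \<kappa>) / (\<kappa> * x / 32)"
      by (rule divide_right_mono) (use \<kappa> x in simp)
    also have "\<dots> = 256 * c ^ 3 / \<kappa>\<^sup>2 / x" using \<kappa> x by (simp add: power2_eq_square field_simps)
    finally show ?thesis
      using Markov_bad_edges[OF nq(2), of "\<kappa> * x / 32"] \<kappa> x by (simp add: B_def numeral_3_eq_3)
  qed
  have p5: "measure_pmf.prob labels (B ! 4) \<le> (1 + c + 8 * c\<^sup>2 / \<kappa>) / \<kappa>\<^sub>1 / x"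
  proof -
    have "real n + (real n)\<^sup>2 * (q + q\<^sup>2 * (real n / (1 - real n * q\<^sub>0)))
        = x * (1 + x * q + (x * q)\<^sup>2 * (8 / \<kappa>))"
      unfolding nq x_def by (simp add: power2_eq_square algebra_simps)
    also have "\<dots> \<le> x * (1 + c + c\<^sup>2 * (8 / \<kappa>))"
      using xq x q0 \<kappa> by (intro mult_left_mono add_mono mult_right_mono power_mono) auto
    finally have "(real n + (real n)\<^sup>2 * (q + q\<^sup>2 * (real n / (1 - real n * q\<^sub>0)))) / (\<kappa>\<^sub>1 * x\<^sup>2)
        \<le> x * (1 + c + c\<^sup>2 * (8 / \<kappa>)) / (\<kappa>\<^sub>1 * x\<^sup>2)"
      by (rule divide_right_mono) (use \<kappa>\<^sub>1_pos in simp)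
    also have "\<dots> = (1 + c + 8 * c\<^sup>2 / \<kappa>) / \<kappa>\<^sub>1 / x"
      using \<kappa>\<^sub>1_pos x by (simp add: power2_eq_square)
    finally show ?thesis
      using Markov_linked_pairs[OF nq(2), of "\<kappa>\<^sub>1 * x\<^sup>2"] \<kappa>\<^sub>1_pos x by (simp add: B_def)
  qed
  let ?C = "2 / c + 512 / \<kappa>\<^sup>2 + (8 * c + 8 * c ^ 3) / \<kappa>\<^sup>2 + 256 * c ^ 3 / \<kappa>\<^sup>2
      + (1 + c + 8 * c\<^sup>2 / \<kappa>) / \<kappa>\<^sub>1"
  have "measure_pmf.prob labels (\<Union>i<5. B ! i) \<le> (\<Sum>i<5. measure_pmf.prob labels (B ! i))"
    by (intro measure_pmf.finite_measure_subadditive_finite) auto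
  also have "\<dots> \<le> ?C / x"
    using p1 p2 p3 p4 p5 by (simp add: eval_nat_numeral add_divide_distrib)
  finally have "measure_pmf.prob labels (\<Union>i<5. B ! i) \<le> ?C / x" .
  moreover have "- (\<Union>i<5. B ! i) \<subseteq> {l. \<kappa> / 64 / real n \<le> modularity V (all_edges V - hi l)
      \<and> modularity V (all_edges V - hi l) \<le> 8 * c / real n}"
  proof
    fix l assume "l \<in> - (\<Union>i<5. B ! i)"
    then have nB: "l \<notin> B ! i" if "i < 5" for i using that by blast
    have M: "real (card (hi l)) \<le> c * real n"
    proof -
      have "?N * q = (x - 1) * (x * q) / 2" by (simp add: x_def)
      also have "\<dots> \<le> x * c / 2" using xq x q0 by (intro divide_right_mono mult_mono) auto
      finally have "?N * q \<le> c * x / 2" by (simp add: mult.commute)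
      moreover have "\<not> c * x / 2 \<le> \<bar>real (card (hi l)) - ?N * q\<bar>"
        using nB[of 0] by (simp add: B_def)
      moreover have "h \<le> z" if "\<not> z / 2 \<le> \<bar>h - y\<bar>" "y \<le> z / 2" for h y z :: real
        using that by linarith
      ultimately show ?thesis unfolding x_def by blast
    qed
    have lo: "real n / 2 * (1 - \<kappa> / 8) - \<kappa> * real n / 16 \<le> real (card (lo l))"
    proof -
      \<comment> \<open>The mean uses \<open>n - 1\<close> in place of \<open>n\<close>, which loses
        at most \<open>1 / 2\<close>; for large \<open>n\<close> this fits into a second share
        \<open>\<kappa> * x / 32\<close>.\<close>
      have "\<kappa> * x \<ge> 128 * c\<^sup>2" using n(2) \<kappa> by (simp add: x_def field_simps)
      moreover have "c\<^sup>2 \<ge> 1" using c by simp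
      ultimately have kx: "1 / 2 \<le> \<kappa> * x / 32" by simp
      have "?N * q\<^sub>0 = (x - 1) * (real n * q\<^sub>0) / 2" by (simp add: x_def)
      also have "\<dots> \<ge> x / 2 * (1 - \<kappa> / 8) - 1 / 2"
        unfolding q\<^sub>0 using \<kappa> by (simp add: field_simps)
      finally have "x / 2 * (1 - \<kappa> / 8) - 1 / 2 \<le> ?N * q\<^sub>0" .
      moreover have "\<not> \<kappa> * x / 32 \<le> \<bar>real (card (lo l)) - ?N * q\<^sub>0\<bar>"
        using nB[of 1] by (simp add: B_def)
      moreover have "a - z / 16 \<le> h"
        if "a - 1 / 2 \<le> y" "\<not> z / 32 \<le> \<bar>h - y\<bar>" "1 / 2 \<le> z / 32" for a h y z :: real
        using that by linarith
      ultimately show ?thesis using kx unfolding x_def by blast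
    qed
    have lf: "\<kappa> * real n / 2 \<le> real (leaf_count l)"
    proof -
      have "x * \<kappa> \<le> x * ((real n - 1) * leaf_prob)" using leaf x by (intro mult_left_mono) auto
      then have "\<kappa> * x \<le> real n * (real n - 1) * leaf_prob"
        by (simp add: x_def mult.assoc mult.commute[of \<kappa>])
      moreover have "\<not> \<kappa> * x / 2 \<le> \<bar>real (leaf_count l) - real n * (real n - 1) * leaf_prob\<bar>"
        using nB[of 2] by (simp add: B_def)
      moreover have "z / 2 \<le> h" if "z \<le> y" "\<not> z / 2 \<le> \<bar>h - y\<bar>" for h y z :: real
        using that by linarith
      ultimately show ?thesis unfolding x_def by blast
    qed
    have b: "real (card (bad_edges (core l) (hi l))) \<le> \<kappa> * real n / 32"
      using nB[of 3] by (simp add: B_def x_def)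
    have li: "real (card (linked_pairs V (core l))) \<le> \<kappa>\<^sub>1 * (real n)\<^sup>2"
      using nB[of 4] by (simp add: B_def x_def)
    show "l \<in> {l. \<kappa> / 64 / real n \<le> modularity V (all_edges V - hi l)
      \<and> modularity V (all_edges V - hi l) \<le> 8 * c / real n}"
      using modularity_bounds[OF _ \<kappa>(1) \<kappa>\<^sub>1 n M lo lf b li] c by simp
  qed
  ultimately show ?thesis
    unfolding prob_binomial_random_graph V_def[symmetric] x_def by (rule prob_compl_ge)
qed

end

section \<open>Concrete labellings and the passage to the limit\<close>

lemma edge_labelling_bernoulli:
  assumes "0 \<le> p" "p \<le> 1"
  shows "edge_labelling (bernoulli_pmf p) False {False} {} (1 - p) 0"
  using assms by unfold_locales (auto simp: measure_pmf_single)

text \<open>The second coin thins the complement: an absent edge enters \<open>lo l\<close> with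
  probability \<open>r\<close>.\<close>

lemma edge_labelling_pair_bernoulli:
  assumes "0 \<le> p" "p \<le> 1" "0 \<le> r" "r \<le> 1"
  shows "edge_labelling (pair_pmf (bernoulli_pmf p) (bernoulli_pmf r)) (False, False)
    {x. \<not> fst x} {x. \<not> fst x \<and> snd x} (1 - p) ((1 - p) * r)"
proof
  let ?D = "pair_pmf (bernoulli_pmf p) (bernoulli_pmf r)"
  have eq: "{x :: bool \<times> bool. \<not> fst x} = {(False, False), (False, True)}"
    "{x :: bool \<times> bool. \<not> fst x \<and> snd x} = {(False, True)}" by auto
  show "measure_pmf.prob ?D {x. \<not> fst x} = 1 - p"
    unfolding eq using assms
    by (simp add: measure_measure_pmf_finite pmf_pair algebra_simps)
  show "measure_pmf.prob ?D {x. \<not> fst x \<and> snd x} = (1 - p) * r"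
    unfolding eq using assms by (simp add: measure_pmf_single pmf_pair)
qed auto

lemma tendsto_prob_1:
  assumes "\<forall>\<^sub>F n in sequentially. 1 - f n \<le> measure_pmf.prob (P n) (A n)" "f \<longlonglongrightarrow> 0"
  shows "(\<lambda>n. measure_pmf.prob (P n) (A n)) \<longlonglongrightarrow> 1"
proof (rule tendsto_sandwich[OF assms(1) _ _ tendsto_const])
  show "(\<lambda>n. 1 - f n) \<longlonglongrightarrow> 1" using tendsto_diff[OF tendsto_const assms(2), of 1] by simp
qed (auto intro!: always_eventually)

theorem theorem1p4:
  shows
    "(\<forall>(p :: nat \<Rightarrow> real) (\<omega> :: nat \<Rightarrow> real).
        (\<forall>n. 0 \<le> p n \<and> p n \<le> 1) \<longrightarrow>
        filterlim \<omega> at_top sequentially \<longrightarrow>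
        (\<forall>\<^sub>F n in sequentially. p n \<ge> 1 - 1 / real n + \<omega> n / real n powr (3 / 2)) \<longrightarrow>
        (\<lambda>n. measure_pmf.prob (binomial_random_graph n (p n))
               {E. modularity {1..n} E = 0}) \<longlonglongrightarrow> 1)
     \<and>
     (\<forall>c1 c2 :: real. 1 < c1 \<longrightarrow> c1 < c2 \<longrightarrow>
        (\<exists>\<alpha> \<beta> :: real. 0 < \<alpha> \<and> \<alpha> < \<beta> \<and>
           (\<forall>p :: nat \<Rightarrow> real.
              (\<forall>n. 0 \<le> p n \<and> p n \<le> 1) \<longrightarrow>
              (\<forall>\<^sub>F n in sequentially. 1 - c2 / real n \<le> p n \<and> p n \<le> 1 - c1 / real n) \<longrightarrow>
              (\<lambda>n. measure_pmf.prob (binomial_random_graph n (p n))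
                     {E. \<alpha> / real n \<le> modularity {1..n} E \<and> modularity {1..n} E \<le> \<beta> / real n})
                \<longlonglongrightarrow> 1)))"
proof (intro conjI allI impI)
  fix p \<omega> :: "nat \<Rightarrow> real"
  assume p: "\<forall>n. 0 \<le> p n \<and> p n \<le> 1" and \<omega>: "filterlim \<omega> at_top sequentially"
    and ev: "\<forall>\<^sub>F n in sequentially. p n \<ge> 1 - 1 / real n + \<omega> n / real n powr (3 / 2)"
  have "\<forall>\<^sub>F n in sequentially. \<omega> n > 0" using \<omega> by (simp add: filterlim_at_top_dense)
  with ev eventually_ge_at_top[of 2]
  have "\<forall>\<^sub>F n in sequentially. 1 - 8 / (\<omega> n)\<^sup>2
      \<le> measure_pmf.prob (binomial_random_graph n (p n)) {E. modularity {1..n} E = 0}"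
  proof eventually_elim
    case (elim n)
    interpret edge_labelling n "bernoulli_pmf (p n)" False "{False}" "{}" "1 - p n" 0
      using p by (intro edge_labelling_bernoulli) auto
    show ?case using prob_modularity_eq_0[of "\<omega> n"] elim by simp
  qed
  moreover have "(\<lambda>n. 8 / (\<omega> n)\<^sup>2) \<longlonglongrightarrow> 0"
    by (intro real_tendsto_divide_at_top[OF tendsto_const] filterlim_pow_at_top \<omega>) simp
  ultimately show "(\<lambda>n. measure_pmf.prob (binomial_random_graph n (p n))
      {E. modularity {1..n} E = 0}) \<longlonglongrightarrow> 1"
    by (rule tendsto_prob_1)
next
  fix c\<^sub>1 c :: real
  assume c: "1 < c\<^sub>1" "c\<^sub>1 < c"
  \<comment> \<open>Since \<open>n q \<ge> c\<^sub>1\<close> and \<open>n q\<^sub>0 \<le> 1\<close>,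
    the expected number of leaf events per vertex is asymptotically at least
    \<open>(c\<^sub>1 - 1) * exp (- c)\<close>; half of it leaves room for convergence. This bound
    does not involve the thinning, so \<open>\<eta> = \<kappa> / 8\<close> is not circular.\<close>
  define \<kappa> where "\<kappa> = (c\<^sub>1 - 1) * exp (- c) / 2"
  have \<kappa>0: "\<kappa> > 0" using c by (simp add: \<kappa>_def)
  have \<kappa>1: "\<kappa> < 1"
  proof -
    have "c\<^sub>1 - 1 < exp c" using c exp_ge_add_one_self[of c] by linarith
    then have "c\<^sub>1 - 1 < 2 * exp c" using exp_gt_zero[of c] by linarith
    then show ?thesis by (simp add: \<kappa>_def exp_minus field_simps)
  qed
  define b where "b = (2 + 128 * c / \<kappa>) * (c / 4)"
  have b: "b > 0" unfolding b_def using c \<kappa>0 by (intro mult_pos_pos add_pos_pos) auto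
  \<comment> \<open>Solves the equation that gives the linked pairs their share of the
    error.\<close>
  define \<kappa>\<^sub>1 where "\<kappa>\<^sub>1 = \<kappa> / 128 / b"
  have \<kappa>\<^sub>1: "(2 + 128 * c / \<kappa>) * (c / 4) * \<kappa>\<^sub>1 = \<kappa> / 128"
    using b unfolding b_def[symmetric] by (simp add: \<kappa>\<^sub>1_def)
  show "\<exists>\<alpha> \<beta> :: real. 0 < \<alpha> \<and> \<alpha> < \<beta> \<and>
           (\<forall>p :: nat \<Rightarrow> real.
              (\<forall>n. 0 \<le> p n \<and> p n \<le> 1) \<longrightarrow>
              (\<forall>\<^sub>F n in sequentially. 1 - c / real n \<le> p n \<and> p n \<le> 1 - c\<^sub>1 / real n) \<longrightarrow>
              (\<lambda>n. measure_pmf.prob (binomial_random_graph n (p n))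
                     {E. \<alpha> / real n \<le> modularity {1..n} E \<and> modularity {1..n} E \<le> \<beta> / real n})
                \<longlonglongrightarrow> 1)"
  proof (intro exI conjI allI impI)
    show "0 < \<kappa> / 64" using \<kappa>0 by simp
    show "\<kappa> / 64 < 8 * c" using \<kappa>1 c by simp
    fix p :: "nat \<Rightarrow> real"
    assume p: "\<forall>n. 0 \<le> p n \<and> p n \<le> 1"
      and ev: "\<forall>\<^sub>F n in sequentially. 1 - c / real n \<le> p n \<and> p n \<le> 1 - c\<^sub>1 / real n"
    define C where "C = 2 / c + 512 / \<kappa>\<^sup>2 + (8 * c + 8 * c ^ 3) / \<kappa>\<^sup>2 + 256 * c ^ 3 / \<kappa>\<^sup>2
      + (1 + c + 8 * c\<^sup>2 / \<kappa>) / \<kappa>\<^sub>1"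
    have "(\<lambda>n. (1 - 1 / real n) * (c\<^sub>1 - 1) * (1 + (- c) / real n) ^ n) \<longlonglongrightarrow> (1 - 0) * (c\<^sub>1 - 1) * exp (- c)"
      by (intro tendsto_intros tendsto_exp_limit_sequentially lim_const_over_n)
    then have "\<forall>\<^sub>F n in sequentially. (1 - 1 / real n) * (c\<^sub>1 - 1) * (1 + (- c) / real n) ^ n > \<kappa>"
      by (rule order_tendstoD) (use \<kappa>0 in \<open>simp add: \<kappa>_def\<close>)
    moreover have "\<forall>\<^sub>F n in sequentially. real n \<ge> max (2 + 4 * c) (128 * c\<^sup>2 / \<kappa>)"
      using filterlim_real_sequentially by (simp only: filterlim_at_top)
    ultimately have "\<forall>\<^sub>F n in sequentially. 1 - C / real n
      \<le> measure_pmf.prob (binomial_random_graph n (p n))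
        {E. \<kappa> / 64 / real n \<le> modularity {1..n} E \<and> modularity {1..n} E \<le> 8 * c / real n}"
      using ev
    proof eventually_elim
      case (elim n)
      define q where "q = 1 - p n"
      \<comment> \<open>Makes the thinned copy subcritical with
        \<open>n q\<^sub>0 = 1 - \<kappa> / 8\<close>; it is a probability because
        \<open>n q \<ge> c\<^sub>1 > 1\<close>.\<close>
      define r where "r = (1 - \<kappa> / 8) / (real n * q)"
      have n: "real n \<ge> 2 + 4 * c" "real n \<ge> 128 * c\<^sup>2 / \<kappa>" using elim by auto
      then have n0: "real n > 0" using c by linarith
      have q: "c\<^sub>1 / real n \<le> q" "q \<le> c / real n" using elim by (auto simp: q_def)
      have nq: "real n * q \<ge> c\<^sub>1" using q n0 by (simp add: field_simps)
      have r: "0 \<le> r" "r \<le> 1" using nq c \<kappa>0 \<kappa>1 by (auto simp: r_def field_simps)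
      interpret edge_labelling n "pair_pmf (bernoulli_pmf (p n)) (bernoulli_pmf r)" "(False, False)"
        "{x. \<not> fst x}" "{x. \<not> fst x \<and> snd x}" q "q * r"
        unfolding q_def using p r by (intro edge_labelling_pair_bernoulli) auto
      have q0: "real n * (q * r) = 1 - \<kappa> / 8" using nq c n0 by (cases "q = 0") (simp_all add: r_def)
      have "\<kappa> \<le> (real n - 1) * ((c\<^sub>1 - 1) / real n * (1 - c / real n) ^ n)"
        using elim(1) n0 by (simp add: field_simps)
      also have "\<dots> \<le> (real n - 1) * leaf_prob"
      proof (intro mult_left_mono)
        have "c / real n \<le> 1" using n c n0 by (simp add: field_simps)
        then have "(1 - c / real n) ^ n \<le> (1 - q) ^ n" using q by (intro power_mono) auto
        also have "\<dots> \<le> (1 - q) ^ (n - 2)" using q_bounds by (intro power_decreasing) auto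
        finally have "(1 - c / real n) ^ n \<le> (1 - q) ^ (n - 2)" .
        moreover have "(c\<^sub>1 - 1) / real n \<le> q - q * r"
        proof -
          have "c\<^sub>1 - 1 \<le> real n * (q - q * r)" using nq q0 \<kappa>0 by (simp add: right_diff_distrib)
          then show ?thesis using n0 by (simp add: field_simps)
        qed
        ultimately show "(c\<^sub>1 - 1) / real n * (1 - c / real n) ^ n \<le> leaf_prob"
          unfolding leaf_prob_def using \<open>c / real n \<le> 1\<close> q_bounds by (intro mult_mono) auto
      qed (use n c in simp)
      finally have "\<kappa> \<le> (real n - 1) * leaf_prob" .
      from prob_modularity_bounds[OF _ \<kappa>0 \<kappa>1 \<kappa>\<^sub>1 n q(2) q0 this]
      show ?case using c by (simp add: C_def q_def)
    qed
    moreover have "(\<lambda>n. C / real n) \<longlonglongrightarrow> 0" by (rule lim_const_over_n)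
    ultimately show "(\<lambda>n. measure_pmf.prob (binomial_random_graph n (p n))
        {E. \<kappa> / 64 / real n \<le> modularity {1..n} E \<and> modularity {1..n} E \<le> 8 * c / real n}) \<longlonglongrightarrow> 1"
      by (rule tendsto_prob_1)
  qed
qed

end
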